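(* Let $\Phi(x)$ be an $\mathcal{L}_A$-formula satisfying the conditions $\mathbf{D1}$, $\mathbf{B}_2$ and $\mathbf{D3}$. Then $T \nvdash \mathrm{Con}^H_\Phi$, where $\mathrm{Con}^H_\Phi :\equiv \forall x(\mathrm{Fml}(x)\land\Phi(x)\to\neg\Phi(\dot\neg x))$.
   Context: $\mathcal{L}_A$ is the language of first-order arithmetic containing $0,\mathsf{s},+,\times$ (and possibly function symbols for some primitive recursive functions); $\mathsf{PA}$ is Peano Arithmetic. $S$ and $T$ are recursively axiomatized consistent extensions of $\mathsf{PA}$ in $\mathcal{L}_A$, and $T$ extends $S$. A natural Gödel numbering is fixed; $\ulcorner\varphi\urcorner$ is the numeral of the Gödel number of $\varphi$. $\dot\neg x$ is a primitive recursive term with $\mathsf{PA}\vdash\dot\neg\ulcorner\varphi\urcorner=\ulcorner\neg\varphi\urcorner$ for all formulas $\varphi$. $\mathrm{Fml}(x)$ is a $\Delta_1$ formula expressing "$x$ is the Gödel number of an $\mathcal{L}_A$-formula". $\Phi(x)$ is an arbitrary formula with one free variable. Conditions: $\mathbf{D1}$: for every formula $\varphi$, if $T\vdash\varphi$ then $S\vdash\Phi(\ulcorner\varphi\urcorner)$. $\mathbf{B}_2$: for all formulas $\varphi,\psi$, if $T\vdash\varphi\to\psi$ then $S\vdash\Phi(\ulcorner\varphi\urcorner)\to\Phi(\ulcorner\psi\urcorner)$. $\mathbf{D3}$: for every formula $\varphi$, $S\vdash\Phi(\ulcorner\varphi\urcorner)\to\Phi(\ulcorner\Phi(\ulcorner\varphi\urcorner)\urcorner)$.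 *)

theory Defs
  imports Main "HOL-Library.Nat_Bijection"
begin

section \<open>Languages of arithmetic\<close>

text \<open>
  Variables are de Bruijn indices. A function symbol is a primitive recursive definition:
  \<open>PrimRec k t u\<close> names the \<open>(k+1)\<close>-ary function with \<open>f(0, xs) = t(xs)\<close> and
  \<open>f(y+1, xs) = u(f(y, xs), y, xs)\<close>, where \<open>xs\<close> has length \<open>k\<close> and the variables
  \<open>0, 1, \<dots>\<close> of \<open>t\<close> and \<open>u\<close> denote the displayed arguments from left to right.
\<close>

datatype tm = Var nat | Zero | Succ tm | Plus tm tm | Times tm tm | App fsym "tm list"
  and fsym = PrimRec nat tm tm

datatype fm = Eq tm tm | Neg fm | Imp fm fm | All fm

primrec arity :: "fsym \<Rightarrow> nat" where
  "arity (PrimRec k t u) = Suc k"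

primrec fv_tm :: "tm \<Rightarrow> nat set" where
  "fv_tm (Var n) = {n}"
| "fv_tm Zero = {}"
| "fv_tm (Succ t) = fv_tm t"
| "fv_tm (Plus s t) = fv_tm s \<union> fv_tm t"
| "fv_tm (Times s t) = fv_tm s \<union> fv_tm t"
| "fv_tm (App f ts) = \<Union>(set (map fv_tm ts))"

primrec fv_fm :: "fm \<Rightarrow> nat set" where
  "fv_fm (Eq s t) = fv_tm s \<union> fv_tm t"
| "fv_fm (Neg \<phi>) = fv_fm \<phi>"
| "fv_fm (Imp \<phi> \<psi>) = fv_fm \<phi> \<union> fv_fm \<psi>"
| "fv_fm (All \<phi>) = {n. Suc n \<in> fv_fm \<phi>}"

text \<open>
  \<open>wf_tm F\<close> and \<open>wf_fm F\<close> single out the terms and formulas of the language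
  with \<open>0\<close>, \<open>s\<close>, \<open>+\<close>, \<open>\<times>\<close> and the function symbols in \<open>F\<close>.
\<close>

primrec wf_tm :: "fsym set \<Rightarrow> tm \<Rightarrow> bool" where
  "wf_tm F (Var n) \<longleftrightarrow> True"
| "wf_tm F Zero \<longleftrightarrow> True"
| "wf_tm F (Succ t) \<longleftrightarrow> wf_tm F t"
| "wf_tm F (Plus s t) \<longleftrightarrow> wf_tm F s \<and> wf_tm F t"
| "wf_tm F (Times s t) \<longleftrightarrow> wf_tm F s \<and> wf_tm F t"
| "wf_tm F (App f ts) \<longleftrightarrow> f \<in> F \<and> length ts = arity f \<and> list_all (wf_tm F) ts"

primrec wf_fm :: "fsym set \<Rightarrow> fm \<Rightarrow> bool" where
  "wf_fm F (Eq s t) \<longleftrightarrow> wf_tm F s \<and> wf_tm F t"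
| "wf_fm F (Neg \<phi>) \<longleftrightarrow> wf_fm F \<phi>"
| "wf_fm F (Imp \<phi> \<psi>) \<longleftrightarrow> wf_fm F \<phi> \<and> wf_fm F \<psi>"
| "wf_fm F (All \<phi>) \<longleftrightarrow> wf_fm F \<phi>"

text \<open>
  The terms defining a symbol of the language must themselves be terms of the language,
  so that its defining equations are formulas of the language.
\<close>

definition pr_language :: "fsym set \<Rightarrow> bool" where
  "pr_language F \<longleftrightarrow> (\<forall>k t u. PrimRec k t u \<in> F \<longrightarrow>
     wf_tm F t \<and> fv_tm t \<subseteq> {..<k} \<and> wf_tm F u \<and> fv_tm u \<subseteq> {..<k + 2})"

primrec subst_tm :: "(nat \<Rightarrow> tm) \<Rightarrow> tm \<Rightarrow> tm" where
  "subst_tm \<sigma> (Var n) = \<sigma> n"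
| "subst_tm \<sigma> Zero = Zero"
| "subst_tm \<sigma> (Succ t) = Succ (subst_tm \<sigma> t)"
| "subst_tm \<sigma> (Plus s t) = Plus (subst_tm \<sigma> s) (subst_tm \<sigma> t)"
| "subst_tm \<sigma> (Times s t) = Times (subst_tm \<sigma> s) (subst_tm \<sigma> t)"
| "subst_tm \<sigma> (App f ts) = App f (map (subst_tm \<sigma>) ts)"

abbreviation lift_tm :: "tm \<Rightarrow> tm" where
  "lift_tm \<equiv> subst_tm (\<lambda>n. Var (Suc n))"

primrec subst_fm :: "(nat \<Rightarrow> tm) \<Rightarrow> fm \<Rightarrow> fm" where
  "subst_fm \<sigma> (Eq s t) = Eq (subst_tm \<sigma> s) (subst_tm \<sigma> t)"
| "subst_fm \<sigma> (Neg \<phi>) = Neg (subst_fm \<sigma> \<phi>)"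
| "subst_fm \<sigma> (Imp \<phi> \<psi>) = Imp (subst_fm \<sigma> \<phi>) (subst_fm \<sigma> \<psi>)"
| "subst_fm \<sigma> (All \<phi>) = All (subst_fm (case_nat (Var 0) (\<lambda>n. lift_tm (\<sigma> n))) \<phi>)"

abbreviation lift_fm :: "fm \<Rightarrow> fm" where
  "lift_fm \<equiv> subst_fm (\<lambda>n. Var (Suc n))"

text \<open>
  \<open>inst \<phi> t\<close> instantiates the body \<open>\<phi>\<close> of a quantifier: variable \<open>0\<close> becomes \<open>t\<close>
  and the other variables are shifted down. \<open>plug \<phi> t\<close> is \<open>\<phi>(t)\<close> for a formula
  \<open>\<phi>(x)\<close> whose distinguished variable \<open>x\<close> is variable \<open>0\<close>; other variables stay put.
\<close>

abbreviation inst :: "fm \<Rightarrow> tm \<Rightarrow> fm" where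
  "inst \<phi> t \<equiv> subst_fm (case_nat t Var) \<phi>"

abbreviation plug :: "fm \<Rightarrow> tm \<Rightarrow> fm" where
  "plug \<phi> t \<equiv> subst_fm (Var(0 := t)) \<phi>"

abbreviation Conj :: "fm \<Rightarrow> fm \<Rightarrow> fm" where
  "Conj \<phi> \<psi> \<equiv> Neg (Imp \<phi> (Neg \<psi>))"

abbreviation Iff :: "fm \<Rightarrow> fm \<Rightarrow> fm" where
  "Iff \<phi> \<psi> \<equiv> Conj (Imp \<phi> \<psi>) (Imp \<psi> \<phi>)"

abbreviation Exi :: "fm \<Rightarrow> fm" where
  "Exi \<phi> \<equiv> Neg (All (Neg \<phi>))"

abbreviation Less :: "tm \<Rightarrow> tm \<Rightarrow> fm" where
  "Less s t \<equiv> Exi (Eq (Plus (lift_tm s) (Succ (Var 0))) (lift_tm t))"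

definition nml :: "nat \<Rightarrow> tm" where
  "nml n = (Succ ^^ n) Zero"


section \<open>Provability\<close>

text \<open>
  Classical natural deduction with equality, inside the language given by \<open>F\<close>.
  Axioms from \<open>T\<close> are available in every context and are not lifted by \<open>AllI\<close>,
  so an axiom with free variables stands for its universal closure.
\<close>

inductive nd :: "fsym set \<Rightarrow> fm set \<Rightarrow> fm set \<Rightarrow> fm \<Rightarrow> bool"
  for F :: "fsym set" and T :: "fm set"
where
  Ax: "\<phi> \<in> T \<Longrightarrow> nd F T \<Gamma> \<phi>"
| Assm: "\<phi> \<in> \<Gamma> \<Longrightarrow> nd F T \<Gamma> \<phi>"
| ImpI: "wf_fm F \<phi> \<Longrightarrow> nd F T (insert \<phi> \<Gamma>) \<psi> \<Longrightarrow> nd F T \<Gamma> (Imp \<phi> \<psi>)"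
| ImpE: "nd F T \<Gamma> (Imp \<phi> \<psi>) \<Longrightarrow> nd F T \<Gamma> \<phi> \<Longrightarrow> nd F T \<Gamma> \<psi>"
| NegI: "wf_fm F \<phi> \<Longrightarrow> nd F T (insert \<phi> \<Gamma>) \<psi> \<Longrightarrow> nd F T (insert \<phi> \<Gamma>) (Neg \<psi>) \<Longrightarrow>
    nd F T \<Gamma> (Neg \<phi>)"
| Classical: "wf_fm F \<phi> \<Longrightarrow> nd F T (insert (Neg \<phi>) \<Gamma>) \<psi> \<Longrightarrow>
    nd F T (insert (Neg \<phi>) \<Gamma>) (Neg \<psi>) \<Longrightarrow> nd F T \<Gamma> \<phi>"
| AllI: "nd F T (lift_fm ` \<Gamma>) \<phi> \<Longrightarrow> nd F T \<Gamma> (All \<phi>)"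
| AllE: "nd F T \<Gamma> (All \<phi>) \<Longrightarrow> wf_tm F t \<Longrightarrow> nd F T \<Gamma> (inst \<phi> t)"
| Refl: "wf_tm F t \<Longrightarrow> nd F T \<Gamma> (Eq t t)"
| Leibniz: "wf_fm F \<phi> \<Longrightarrow> nd F T \<Gamma> (Eq s t) \<Longrightarrow> wf_tm F s \<Longrightarrow> wf_tm F t \<Longrightarrow>
    nd F T \<Gamma> (inst \<phi> s) \<Longrightarrow> nd F T \<Gamma> (inst \<phi> t)"

definition proves :: "fsym set \<Rightarrow> fm set \<Rightarrow> fm \<Rightarrow> bool" where
  "proves F T \<phi> \<longleftrightarrow> nd F T {} \<phi>"

definition consistent :: "fsym set \<Rightarrow> fm set \<Rightarrow> bool" where
  "consistent F T \<longleftrightarrow> \<not> (\<exists>\<phi>. proves F T \<phi> \<and> proves F T (Neg \<phi>))"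

definition extends :: "fsym set \<Rightarrow> fm set \<Rightarrow> fm set \<Rightarrow> bool" where
  "extends F T S \<longleftrightarrow> (\<forall>\<phi>. proves F S \<phi> \<longrightarrow> proves F T \<phi>)"

inductive_set PA :: "fsym set \<Rightarrow> fm set" for F :: "fsym set" where
  succ_neq_zero: "Neg (Eq (Succ (Var 0)) Zero) \<in> PA F"
| succ_inj: "Imp (Eq (Succ (Var 0)) (Succ (Var 1))) (Eq (Var 0) (Var 1)) \<in> PA F"
| plus_zero: "Eq (Plus (Var 0) Zero) (Var 0) \<in> PA F"
| plus_succ: "Eq (Plus (Var 0) (Succ (Var 1))) (Succ (Plus (Var 0) (Var 1))) \<in> PA F"
| times_zero: "Eq (Times (Var 0) Zero) Zero \<in> PA F"
| times_succ: "Eq (Times (Var 0) (Succ (Var 1))) (Plus (Times (Var 0) (Var 1)) (Var 0)) \<in> PA F"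
| pr_zero: "PrimRec k t u \<in> F \<Longrightarrow>
    Eq (App (PrimRec k t u) (Zero # map Var [0..<k])) t \<in> PA F"
| pr_succ: "PrimRec k t u \<in> F \<Longrightarrow>
    Eq (App (PrimRec k t u) (Succ (Var 0) # map Var [1..<Suc k]))
       (subst_tm (case_nat (App (PrimRec k t u) (map Var [0..<Suc k])) Var) u) \<in> PA F"
| induct_ax: "wf_fm F \<phi> \<Longrightarrow>
    Imp (inst \<phi> Zero) (Imp (All (Imp \<phi> (plug \<phi> (Succ (Var 0))))) (All \<phi>)) \<in> PA F"


section \<open>Goedel numbering\<close>

primrec gn_tm :: "tm \<Rightarrow> nat" and gn_fsym :: "fsym \<Rightarrow> nat" where
  "gn_tm (Var n) = 6 * n"
| "gn_tm Zero = 1"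
| "gn_tm (Succ t) = 6 * gn_tm t + 2"
| "gn_tm (Plus s t) = 6 * prod_encode (gn_tm s, gn_tm t) + 3"
| "gn_tm (Times s t) = 6 * prod_encode (gn_tm s, gn_tm t) + 4"
| "gn_tm (App f ts) = 6 * prod_encode (gn_fsym f, list_encode (map gn_tm ts)) + 5"
| "gn_fsym (PrimRec k t u) = prod_encode (k, prod_encode (gn_tm t, gn_tm u))"

primrec gn :: "fm \<Rightarrow> nat" where
  "gn (Eq s t) = 4 * prod_encode (gn_tm s, gn_tm t)"
| "gn (Neg \<phi>) = 4 * gn \<phi> + 1"
| "gn (Imp \<phi> \<psi>) = 4 * prod_encode (gn \<phi>, gn \<psi>) + 2"
| "gn (All \<phi>) = 4 * gn \<phi> + 3"

lemma gn_tm_inj: "gn_tm t = gn_tm t' \<Longrightarrow> t = t'"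
  and gn_fsym_inj: "gn_fsym f = gn_fsym f' \<Longrightarrow> f = f'"
proof (induction t and f arbitrary: t' and f')
  case (Var x) then show ?case by (cases t') (simp_all, presburger+)
next case Zero then show ?case by (cases t') simp_all
next case (Succ x) then show ?case by (cases t') (simp_all, presburger+)
next case (Plus x y) then show ?case by (cases t') (simp_all, presburger+)
next case (Times x y) then show ?case by (cases t') (simp_all, presburger+)
next case (App f ts)
  show ?case
  proof (cases t')
    case (App g us)
    with App.prems have "gn_fsym f = gn_fsym g" "map gn_tm ts = map gn_tm us"
      by (simp_all add: inj_eq[OF inj_list_encode[of UNIV]])
    moreover have "ts = us"
      by (rule list.inj_map_strong[OF _ \<open>map gn_tm ts = _\<close>]) (rule App.IH(2))
    ultimately show ?thesis using \<open>t' = _\<close> App.IH(1) by simp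
  qed (use App.prems in \<open>simp_all, presburger+\<close>)
next case (PrimRec k t u) then show ?case by (cases f') simp
qed

lemma gn_inj: "gn \<phi> = gn \<psi> \<Longrightarrow> \<phi> = \<psi>"
proof (induction \<phi> arbitrary: \<psi>)
  case (Eq s t) then show ?case by (cases \<psi>) (auto dest: gn_tm_inj, presburger+)
next case (Neg \<phi>) then show ?case by (cases \<psi>) (simp_all, presburger+)
next case (Imp \<phi>1 \<phi>2) then show ?case by (cases \<psi>) (simp_all, presburger+)
next case (All \<phi>) then show ?case by (cases \<psi>) (simp_all, presburger+)
qed

abbreviation quot :: "fm \<Rightarrow> tm" where
  "quot \<phi> \<equiv> nml (gn \<phi>)"


section \<open>Recursive axiomatizations\<close>

datatype recf = RZero | RSucc | RProj nat | RComp recf "recf list" | RPrim recf recf | RMin recf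

text \<open>\<open>reval f xs y\<close>: the partial recursive function \<open>f\<close> is defined at \<open>xs\<close> with value \<open>y\<close>.\<close>

inductive reval :: "recf \<Rightarrow> nat list \<Rightarrow> nat \<Rightarrow> bool" where
  "reval RZero xs 0"
| "reval RSucc [x] (Suc x)"
| "i < length xs \<Longrightarrow> reval (RProj i) xs (xs ! i)"
| "list_all2 (\<lambda>g y. reval g xs y) gs ys \<Longrightarrow> reval f ys z \<Longrightarrow> reval (RComp f gs) xs z"
| "reval f xs z \<Longrightarrow> reval (RPrim f g) (0 # xs) z"
| "reval (RPrim f g) (y # xs) r \<Longrightarrow> reval g (r # y # xs) z \<Longrightarrow> reval (RPrim f g) (Suc y # xs) z"
| "reval f (y # xs) 0 \<Longrightarrow> \<forall>i<y. \<exists>r. reval f (i # xs) (Suc r) \<Longrightarrow> reval (RMin f) xs y"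

definition recursive_set :: "nat set \<Rightarrow> bool" where
  "recursive_set A \<longleftrightarrow> (\<exists>f. \<forall>n. reval f [n] (if n \<in> A then 1 else 0))"

definition recursively_axiomatized :: "fsym set \<Rightarrow> fm set \<Rightarrow> bool" where
  "recursively_axiomatized F T \<longleftrightarrow> (\<forall>\<phi>\<in>T. wf_fm F \<phi>) \<and> recursive_set (gn ` T)"


section \<open>Standard model and arithmetical hierarchy\<close>

primrec eval_tm :: "tm \<Rightarrow> (nat \<Rightarrow> nat) \<Rightarrow> nat" and eval_fsym :: "fsym \<Rightarrow> nat list \<Rightarrow> nat" where
  "eval_tm (Var n) e = e n"
| "eval_tm Zero e = 0"
| "eval_tm (Succ t) e = Suc (eval_tm t e)"
| "eval_tm (Plus s t) e = eval_tm s e + eval_tm t e"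
| "eval_tm (Times s t) e = eval_tm s e * eval_tm t e"
| "eval_tm (App f ts) e = eval_fsym f (map (\<lambda>t. eval_tm t e) ts)"
| "eval_fsym (PrimRec k t u) args =
     rec_nat (eval_tm t ((!) (tl args))) (\<lambda>y r. eval_tm u ((!) (r # y # tl args))) (hd args)"

primrec sat :: "fm \<Rightarrow> (nat \<Rightarrow> nat) \<Rightarrow> bool" where
  "sat (Eq s t) e \<longleftrightarrow> eval_tm s e = eval_tm t e"
| "sat (Neg \<phi>) e \<longleftrightarrow> \<not> sat \<phi> e"
| "sat (Imp \<phi> \<psi>) e \<longleftrightarrow> (sat \<phi> e \<longrightarrow> sat \<psi> e)"
| "sat (All \<phi>) e \<longleftrightarrow> (\<forall>n. sat \<phi> (case_nat n e))"

text \<open>\<open><\<close> is not a symbol of the language, so \<open>Less s t\<close> is counted as an atomic formula.\<close>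

inductive delta0 :: "fm \<Rightarrow> bool" where
  "delta0 (Eq s t)"
| "delta0 (Less s t)"
| "delta0 \<phi> \<Longrightarrow> delta0 (Neg \<phi>)"
| "delta0 \<phi> \<Longrightarrow> delta0 \<psi> \<Longrightarrow> delta0 (Imp \<phi> \<psi>)"
| "delta0 \<phi> \<Longrightarrow> delta0 (All (Imp (Less (Var 0) (lift_tm t)) \<phi>))"
| "delta0 \<phi> \<Longrightarrow> delta0 (Exi (Conj (Less (Var 0) (lift_tm t)) \<phi>))"

inductive sigma1 :: "fm \<Rightarrow> bool" where
  "delta0 \<phi> \<Longrightarrow> sigma1 \<phi>"
| "sigma1 \<phi> \<Longrightarrow> sigma1 (Exi \<phi>)"

inductive pi1 :: "fm \<Rightarrow> bool" where
  "delta0 \<phi> \<Longrightarrow> pi1 \<phi>"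
| "pi1 \<phi> \<Longrightarrow> pi1 (All \<phi>)"

definition delta1 :: "fsym set \<Rightarrow> fm \<Rightarrow> bool" where
  "delta1 F \<phi> \<longleftrightarrow> wf_fm F \<phi> \<and>
     (\<exists>\<sigma>. sigma1 \<sigma> \<and> wf_fm F \<sigma> \<and> proves F (PA F) (Iff \<phi> \<sigma>)) \<and>
     (\<exists>\<pi>. pi1 \<pi> \<and> wf_fm F \<pi> \<and> proves F (PA F) (Iff \<phi> \<pi>))"

definition expresses_Fml :: "fsym set \<Rightarrow> fm \<Rightarrow> bool" where
  "expresses_Fml F Fml \<longleftrightarrow> fv_fm Fml \<subseteq> {0} \<and>
     (\<forall>n e. sat (plug Fml (nml n)) e \<longleftrightarrow> (\<exists>\<phi>. wf_fm F \<phi> \<and> n = gn \<phi>))"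

definition negation_term :: "fsym set \<Rightarrow> tm \<Rightarrow> bool" where
  "negation_term F ng \<longleftrightarrow> wf_tm F ng \<and> fv_tm ng \<subseteq> {0} \<and>
     (\<forall>\<phi>. wf_fm F \<phi> \<longrightarrow>
       proves F (PA F) (Eq (subst_tm (Var(0 := quot \<phi>)) ng) (quot (Neg \<phi>))))"


section \<open>Derivability conditions and consistency statement\<close>

definition D1 :: "fsym set \<Rightarrow> fm set \<Rightarrow> fm set \<Rightarrow> fm \<Rightarrow> bool" where
  "D1 F S T \<Phi> \<longleftrightarrow> (\<forall>\<phi>. wf_fm F \<phi> \<longrightarrow> proves F T \<phi> \<longrightarrow> proves F S (plug \<Phi> (quot \<phi>)))"

definition B2 :: "fsym set \<Rightarrow> fm set \<Rightarrow> fm set \<Rightarrow> fm \<Rightarrow> bool" where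
  "B2 F S T \<Phi> \<longleftrightarrow> (\<forall>\<phi> \<psi>. wf_fm F \<phi> \<longrightarrow> wf_fm F \<psi> \<longrightarrow> proves F T (Imp \<phi> \<psi>) \<longrightarrow>
     proves F S (Imp (plug \<Phi> (quot \<phi>)) (plug \<Phi> (quot \<psi>))))"

definition D3 :: "fsym set \<Rightarrow> fm set \<Rightarrow> fm \<Rightarrow> bool" where
  "D3 F S \<Phi> \<longleftrightarrow> (\<forall>\<phi>. wf_fm F \<phi> \<longrightarrow>
     proves F S (Imp (plug \<Phi> (quot \<phi>)) (plug \<Phi> (quot (plug \<Phi> (quot \<phi>))))))"

definition ConH :: "fm \<Rightarrow> tm \<Rightarrow> fm \<Rightarrow> fm" where
  "ConH Fml ng \<Phi> = All (Imp (Conj Fml \<Phi>) (Neg (plug \<Phi> ng)))"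

end

theory Submission imports Defs "HOL-Number_Theory.Cong" begin

text \<open>
  Let \<open>G\<close> be a fixed point, provably equivalent to \<open>\<not>\<Phi>(G)\<close>. Then \<open>\<Phi>(G)\<close> implies \<open>\<Phi>(\<Phi>(G))\<close> by D3,
  and hence \<open>\<Phi>(\<not>G)\<close> by B2, because \<open>T\<close> proves \<open>\<Phi>(G) \<longrightarrow> \<not>G\<close>. If \<open>T\<close> proved the consistency
  statement, it would therefore refute \<open>\<Phi>(G)\<close>, prove \<open>G\<close>, and by D1 also prove \<open>\<Phi>(G)\<close>.

  The fixed point is needed for a language that may have no symbols besides \<open>0\<close>, \<open>s\<close>, \<open>+\<close>, \<open>\<times>\<close>. It has
  the form \<open>\<forall>x (x = n \<longrightarrow> \<Psi>(x))\<close>, whose code is a polynomial in \<open>n\<close> and the code of the numeral of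
  \<open>n\<close>; the latter satisfies a first-order recursion, expressed with the beta function. The bounded
  formula for the graph is asked for its least witness, so that PA proves uniqueness of the value
  merely by deciding bounded sentences and comparing with numerals.
\<close>

section \<open>Substitution\<close>

text \<open>The mutual induction rule also carries a predicate for function symbols; making that one
  constantly true leaves an induction over terms alone.\<close>

lemma tm_induct [case_names Var Zero Succ Plus Times App]:
  assumes "\<And>n. P (Var n)" "P Zero" "\<And>t. P t \<Longrightarrow> P (Succ t)"
    "\<And>s t. P s \<Longrightarrow> P t \<Longrightarrow> P (Plus s t)" "\<And>s t. P s \<Longrightarrow> P t \<Longrightarrow> P (Times s t)"
    "\<And>f ts. (\<And>t. t \<in> set ts \<Longrightarrow> P t) \<Longrightarrow> P (App f ts)"
  shows "P t"
  by (rule tm.induct[of P "\<lambda>_. True"]) (use assms in auto)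

lemma subst_tm_cong: "(\<And>i. i \<in> fv_tm t \<Longrightarrow> \<sigma> i = \<tau> i) \<Longrightarrow> subst_tm \<sigma> t = subst_tm \<tau> t"
  by (induction t rule: tm_induct) auto

lemma subst_fm_cong: "(\<And>i. i \<in> fv_fm \<phi> \<Longrightarrow> \<sigma> i = \<tau> i) \<Longrightarrow> subst_fm \<sigma> \<phi> = subst_fm \<tau> \<phi>"
proof (induction \<phi> arbitrary: \<sigma> \<tau>)
  case (Eq s t)
  then show ?case by (auto intro: subst_tm_cong)
next
  case (Neg \<phi>)
  have "subst_fm \<sigma> \<phi> = subst_fm \<tau> \<phi>"
    by (rule Neg.IH) (simp add: Neg.prems)
  then show ?case by simp
next
  case (Imp \<phi> \<psi>)
  have "subst_fm \<sigma> \<phi> = subst_fm \<tau> \<phi>" "subst_fm \<sigma> \<psi> = subst_fm \<tau> \<psi>"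
    by (rule Imp.IH; simp add: Imp.prems)+
  then show ?case by simp
next
  case (All \<phi>)
  have "subst_fm (case_nat (Var 0) (\<lambda>n. lift_tm (\<sigma> n))) \<phi>
      = subst_fm (case_nat (Var 0) (\<lambda>n. lift_tm (\<tau> n))) \<phi>"
    by (rule All.IH) (auto simp: All.prems split: nat.split)
  then show ?case by simp
qed

lemma subst_tm_subst_tm: "subst_tm \<sigma> (subst_tm \<tau> t) = subst_tm (\<lambda>i. subst_tm \<sigma> (\<tau> i)) t"
  by (induction t rule: tm_induct) auto

lemma subst_fm_subst_fm: "subst_fm \<sigma> (subst_fm \<tau> \<phi>) = subst_fm (\<lambda>i. subst_tm \<sigma> (\<tau> i)) \<phi>"
  by (induction \<phi> arbitrary: \<sigma> \<tau>)
    (auto simp: subst_tm_subst_tm intro!: subst_fm_cong split: nat.split)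

lemma subst_tm_Var [simp]: "subst_tm Var t = t"
  by (induction t rule: tm_induct) (auto simp: map_idI)

lemma subst_fm_Var [simp]: "subst_fm Var \<phi> = \<phi>"
proof (induction \<phi>)
  case (All \<phi>)
  have "subst_fm (case_nat (Var 0) (\<lambda>n. Var (Suc n))) \<phi> = subst_fm Var \<phi>"
    by (rule subst_fm_cong) (simp split: nat.split)
  with All show ?case by simp
qed auto

lemma subst_fm_id: "(\<And>i. i \<in> fv_fm \<phi> \<Longrightarrow> \<sigma> i = Var i) \<Longrightarrow> subst_fm \<sigma> \<phi> = \<phi>"
  using subst_fm_cong[of \<phi> \<sigma> Var] by simp

lemma finite_fv_tm: "finite (fv_tm t)"
  by (induction t rule: tm_induct) auto

lemma finite_fv_fm: "finite (fv_fm \<phi>)"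
proof (induction \<phi>)
  case (All \<phi>)
  have "fv_fm (All \<phi>) = Suc -` fv_fm \<phi>" by auto
  with All show ?case by (simp add: finite_vimageI)
qed (auto simp: finite_fv_tm)

lemma fv_tm_subst: "fv_tm (subst_tm \<sigma> t) = (\<Union>i\<in>fv_tm t. fv_tm (\<sigma> i))"
  by (induction t rule: tm_induct) auto

lemma wf_tm_subst: "wf_tm F t \<Longrightarrow> (\<And>i. wf_tm F (\<sigma> i)) \<Longrightarrow> wf_tm F (subst_tm \<sigma> t)"
  by (induction t rule: tm_induct) (auto simp: list_all_iff)

lemma wf_fm_subst: "wf_fm F \<phi> \<Longrightarrow> (\<And>i. wf_tm F (\<sigma> i)) \<Longrightarrow> wf_fm F (subst_fm \<sigma> \<phi>)"
proof (induction \<phi> arbitrary: \<sigma>)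
  case (All \<phi>)
  have "wf_tm F (case i of 0 \<Rightarrow> Var 0 | Suc n \<Rightarrow> lift_tm (\<sigma> n))" for i
    using All.prems by (auto intro: wf_tm_subst split: nat.split)
  with All show ?case by simp
qed (auto intro: wf_tm_subst)

lemma wf_tm_lift [simp]: "wf_tm F t \<Longrightarrow> wf_tm F (lift_tm t)"
  by (rule wf_tm_subst) simp_all

lemma wf_fm_lift [simp]: "wf_fm F \<phi> \<Longrightarrow> wf_fm F (lift_fm \<phi>)"
  by (rule wf_fm_subst) simp_all

lemma wf_tm_inst [simp]: "wf_tm F t \<Longrightarrow> wf_tm F s \<Longrightarrow> wf_tm F (subst_tm (case_nat s Var) t)"
  by (rule wf_tm_subst) (simp_all split: nat.split)

lemma wf_fm_inst [simp]: "wf_fm F \<phi> \<Longrightarrow> wf_tm F s \<Longrightarrow> wf_fm F (inst \<phi> s)"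
  by (rule wf_fm_subst) (simp_all split: nat.split)

lemma wf_fm_plug [simp]: "wf_fm F \<phi> \<Longrightarrow> wf_tm F s \<Longrightarrow> wf_fm F (plug \<phi> s)"
  by (rule wf_fm_subst) simp_all

lemma nml_0 [simp]: "nml 0 = Zero"
  and nml_Suc [simp]: "nml (Suc n) = Succ (nml n)"
  by (simp_all add: nml_def)

lemma fv_tm_nml [simp]: "fv_tm (nml n) = {}"
  by (induction n) auto

lemma subst_tm_nml [simp]: "subst_tm \<sigma> (nml n) = nml n"
  by (induction n) auto

lemma wf_tm_nml [simp]: "wf_tm F (nml n)"
  by (induction n) auto

lemma subst_tm_lift_tm [simp]: "subst_tm (case_nat t \<sigma>) (lift_tm s) = subst_tm \<sigma> s"
  by (simp add: subst_tm_subst_tm)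

text \<open>Passing under a quantifier lifts the substituted terms and instantiating it undoes the
  lift, so the two merge into a single substitution.\<close>

lemma inst_subst_fm:
  "inst (subst_fm (case_nat (Var 0) (\<lambda>n. lift_tm (\<sigma> n))) \<phi>) t = subst_fm (case_nat t \<sigma>) \<phi>"
  unfolding subst_fm_subst_fm by (rule subst_fm_cong) (simp split: nat.split)

text \<open>\<open>Less\<close> abbreviates a quantified formula; through this equation substitution
  treats it like an atomic one.\<close>

lemma subst_fm_Less [simp]: "subst_fm \<sigma> (Less s t) = Less (subst_tm \<sigma> s) (subst_tm \<sigma> t)"
  by (simp add: subst_tm_subst_tm)

section \<open>Truth in the standard model\<close>

lemma eval_tm_cong: "(\<And>i. i \<in> fv_tm t \<Longrightarrow> e i = e' i) \<Longrightarrow> eval_tm t e = eval_tm t e'"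
proof (induction t rule: tm_induct)
  case (App f ts)
  then have "map (\<lambda>t. eval_tm t e) ts = map (\<lambda>t. eval_tm t e') ts" by auto
  then show ?case by (simp only: eval_tm.simps)
qed auto

lemma eval_subst_tm: "eval_tm (subst_tm \<sigma> t) e = eval_tm t (\<lambda>i. eval_tm (\<sigma> i) e)"
proof (induction t rule: tm_induct)
  case (App f ts)
  then have "map ((\<lambda>t. eval_tm t e) \<circ> subst_tm \<sigma>) ts = map (\<lambda>t. eval_tm t (\<lambda>i. eval_tm (\<sigma> i) e)) ts"
    by auto
  then show ?case by (simp only: subst_tm.simps eval_tm.simps map_map)
qed auto

lemma eval_nml [simp]: "eval_tm (nml n) e = n"
  by (induction n) auto

lemma sat_subst_fm: "sat (subst_fm \<sigma> \<phi>) e \<longleftrightarrow> sat \<phi> (\<lambda>i. eval_tm (\<sigma> i) e)"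
proof (induction \<phi> arbitrary: \<sigma> e)
  case (All \<phi>)
  have "(\<lambda>i. eval_tm (case i of 0 \<Rightarrow> Var 0 | Suc n \<Rightarrow> lift_tm (\<sigma> n)) (case_nat n e))
      = case_nat n (\<lambda>i. eval_tm (\<sigma> i) e)" for n
    by (auto simp: eval_subst_tm fun_eq_iff split: nat.split)
  then show ?case by (simp add: All.IH)
qed (auto simp: eval_subst_tm)

lemma sat_Less [simp]: "sat (Less s t) e \<longleftrightarrow> eval_tm s e < eval_tm t e"
  by (auto simp: eval_subst_tm dest: less_imp_Suc_add)

text \<open>The axioms must be true under every assignment but the context only under
  \<open>e\<close>: \<open>AllI\<close> changes the assignment and lifts the context accordingly,
  while axioms stay as they are.\<close>

lemma nd_sound:
  assumes "nd F T \<Gamma> \<phi>" and "\<And>\<psi> e. \<psi> \<in> T \<Longrightarrow> sat \<psi> e" and "\<And>\<psi>. \<psi> \<in> \<Gamma> \<Longrightarrow> sat \<psi> e"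
  shows "sat \<phi> e"
  using assms(1,3)
proof (induction arbitrary: e rule: nd.induct)
  case (Ax \<phi> \<Gamma>)
  then show ?case by (simp add: assms(2))
next
  case (ImpI \<phi> \<Gamma> \<psi>)
  have "sat \<psi> e" if "sat \<phi> e" by (rule ImpI.IH) (use that ImpI.prems in auto)
  then show ?case by simp
next
  case (ImpE \<Gamma> \<phi> \<psi>)
  then show ?case using ImpE.IH(1)[of e] ImpE.IH(2)[of e] by simp
next
  case (NegI \<phi> \<Gamma> \<psi>)
  have "sat \<psi> e \<and> sat (Neg \<psi>) e" if "sat \<phi> e"
    by (intro conjI NegI.IH) (use that NegI.prems in auto)
  then show ?case by auto
next
  case (Classical \<phi> \<Gamma> \<psi>)
  have "sat \<psi> e \<and> sat (Neg \<psi>) e" if "\<not> sat \<phi> e"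
    by (intro conjI Classical.IH) (use that Classical.prems in auto)
  then show ?case by auto
next
  case (AllI \<Gamma> \<phi>)
  have "sat \<phi> (case_nat n e)" for n
    by (rule AllI.IH) (auto simp: sat_subst_fm AllI.prems)
  then show ?case by simp
next
  case (AllE \<Gamma> \<phi> t)
  have "(\<lambda>i. eval_tm (case_nat t Var i) e) = case_nat (eval_tm t e) e"
    by (auto simp: fun_eq_iff split: nat.split)
  with AllE.IH[OF AllE.prems] show ?case by (simp add: sat_subst_fm)
next
  case (Leibniz \<phi> \<Gamma> s t)
  have "(\<lambda>i. eval_tm (case_nat s Var i) e) = (\<lambda>i. eval_tm (case_nat t Var i) e)"
    using Leibniz.IH(1)[OF Leibniz.prems] by (auto simp: fun_eq_iff split: nat.split)
  then show ?case using Leibniz.IH(2)[OF Leibniz.prems] by (simp only: sat_subst_fm)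
qed auto

lemma pr_languageD:
  assumes "pr_language F" "PrimRec k t u \<in> F"
  shows "wf_tm F t" "wf_tm F u" "i \<in> fv_tm t \<Longrightarrow> i < k" "i \<in> fv_tm u \<Longrightarrow> i < k + 2"
  using assms unfolding pr_language_def by blast+

lemma PA_sound:
  assumes "pr_language F" "\<phi> \<in> PA F"
  shows "sat \<phi> e"
  using assms(2)
proof cases
  case (pr_zero k t u)
  \<comment> \<open>Beyond the end of a list \<open>!\<close> is unspecified, so list and assignment
    agree on \<open>t\<close> thanks to \<open>pr_language\<close>, which keeps the variables of
    \<open>t\<close> below \<open>k\<close>.\<close>
  have "eval_tm t ((!) (map e [0..<k])) = eval_tm t e"
  proof (rule eval_tm_cong)
    fix i assume "i \<in> fv_tm t"
    then have "i < k" using pr_languageD[OF assms(1)] pr_zero by blast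
    then show "map e [0..<k] ! i = e i" by simp
  qed
  with pr_zero show ?thesis by (simp add: comp_def)
next
  case (pr_succ k t u)
  let ?f = "App (PrimRec k t u) (map Var [0..<Suc k])"
  have *: "map e [0..<Suc k] = e 0 # map e [1..<Suc k]"
    by (simp add: upt_conv_Cons del: upt_Suc)
  have "eval_tm u ((!) (eval_tm ?f e # e 0 # map e [1..<Suc k]))
      = eval_tm u (\<lambda>i. eval_tm (case_nat ?f Var i) e)"
  proof (rule eval_tm_cong)
    fix i assume "i \<in> fv_tm u"
    then have "i < k + 2" using pr_languageD[OF assms(1)] pr_succ by blast
    then show "(eval_tm ?f e # e 0 # map e [1..<Suc k]) ! i = eval_tm (case_nat ?f Var i) e"
      by (auto split: nat.split simp: nth_Cons simp del: upt_Suc)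
  qed
  with pr_succ * show ?thesis
    by (simp add: comp_def eval_subst_tm del: upt_Suc)
next
  case (induct_ax \<psi>)
  have *: "(\<lambda>i. eval_tm (case_nat Zero Var i) e) = case_nat 0 e"
    "(\<lambda>i. eval_tm ((Var(0 := Succ (Var 0))) i) (case_nat n e)) = case_nat (Suc n) e" for n
    by (auto simp: fun_eq_iff split: nat.split)
  have "sat \<psi> (case_nat n e)"
    if "sat \<psi> (case_nat 0 e)" "\<And>n. sat \<psi> (case_nat n e) \<Longrightarrow> sat \<psi> (case_nat (Suc n) e)" for n
    by (induction n) (use that in auto)
  then show ?thesis using induct_ax by (auto simp only: sat.simps sat_subst_fm *)
qed simp_all

lemma wf_PA:
  assumes "pr_language F" "\<phi> \<in> PA F"
  shows "wf_fm F \<phi>"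
  using assms(2)
proof cases
  case (pr_zero k t u)
  then show ?thesis using pr_languageD[OF assms(1)] by (auto simp: list_all_iff)
next
  case (pr_succ k t u)
  have "wf_tm F (subst_tm (case_nat (App (PrimRec k t u) (map Var [0..<Suc k])) Var) u)"
    by (rule wf_tm_subst)
      (use pr_succ pr_languageD[OF assms(1)] in \<open>auto simp: list_all_iff split: nat.split\<close>)
  with pr_succ show ?thesis by (auto simp: list_all_iff simp del: upt_Suc)
next
  case (induct_ax \<psi>)
  then show ?thesis by simp
qed simp_all

section \<open>Derived rules\<close>

lemma nd_mono: "nd F T \<Gamma> \<phi> \<Longrightarrow> \<Gamma> \<subseteq> \<Delta> \<Longrightarrow> nd F T \<Delta> \<phi>"
proof (induction arbitrary: \<Delta> rule: nd.induct)
  case (ImpI \<phi> \<Gamma> \<psi>)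
  then show ?case by (meson insert_mono nd.ImpI)
next
  case (NegI \<phi> \<Gamma> \<psi>)
  then show ?case by (meson insert_mono nd.NegI)
next
  case (Classical \<phi> \<Gamma> \<psi>)
  then show ?case by (meson insert_mono nd.Classical)
next
  case (AllI \<Gamma> \<phi>)
  then show ?case by (intro nd.AllI) (simp add: image_mono)
qed (blast intro: nd.intros)+

lemma nd_insert: "nd F T \<Gamma> \<phi> \<Longrightarrow> nd F T (insert \<psi> \<Gamma>) \<phi>"
  by (erule nd_mono) auto

text \<open>If \<open>\<psi>\<close> is assumed false, the first derivation refutes
  \<open>\<phi>\<close> and the second refutes \<open>Neg \<phi>\<close>.\<close>

lemma nd_cases:
  assumes "wf_fm F \<phi>" "wf_fm F \<psi>" "nd F T (insert \<phi> \<Gamma>) \<psi>" "nd F T (insert (Neg \<phi>) \<Gamma>) \<psi>"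
  shows "nd F T \<Gamma> \<psi>"
proof (rule nd.Classical[OF assms(2)])
  let ?\<Delta> = "insert (Neg \<psi>) \<Gamma>"
  show "nd F T ?\<Delta> (Neg \<phi>)"
  proof (rule nd.NegI[OF assms(1)])
    show "nd F T (insert \<phi> ?\<Delta>) \<psi>" by (rule nd_mono[OF assms(3)]) auto
    show "nd F T (insert \<phi> ?\<Delta>) (Neg \<psi>)" by (rule nd.Assm) simp
  qed
  show "nd F T ?\<Delta> (Neg (Neg \<phi>))"
  proof (rule nd.NegI)
    show "wf_fm F (Neg \<phi>)" using assms(1) by simp
    show "nd F T (insert (Neg \<phi>) ?\<Delta>) \<psi>" by (rule nd_mono[OF assms(4)]) auto
    show "nd F T (insert (Neg \<phi>) ?\<Delta>) (Neg \<psi>)" by (rule nd.Assm) simp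
  qed
qed

lemma nd_explode:
  assumes "wf_fm F \<psi>" "nd F T \<Gamma> \<phi>" "nd F T \<Gamma> (Neg \<phi>)"
  shows "nd F T \<Gamma> \<psi>"
  using assms(1) assms(2,3)[THEN nd_insert] by (rule nd.Classical)

section \<open>Propositional tautologies are derivable (Kalmar's argument)\<close>

primrec pval :: "(fm \<Rightarrow> bool) \<Rightarrow> fm \<Rightarrow> bool" where
  "pval v (Eq s t) \<longleftrightarrow> v (Eq s t)"
| "pval v (Neg \<phi>) \<longleftrightarrow> \<not> pval v \<phi>"
| "pval v (Imp \<phi> \<psi>) \<longleftrightarrow> (pval v \<phi> \<longrightarrow> pval v \<psi>)"
| "pval v (All \<phi>) \<longleftrightarrow> v (All \<phi>)"

primrec prop_atoms :: "fm \<Rightarrow> fm set" where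
  "prop_atoms (Eq s t) = {Eq s t}"
| "prop_atoms (Neg \<phi>) = prop_atoms \<phi>"
| "prop_atoms (Imp \<phi> \<psi>) = prop_atoms \<phi> \<union> prop_atoms \<psi>"
| "prop_atoms (All \<phi>) = {All \<phi>}"

definition literal :: "(fm \<Rightarrow> bool) \<Rightarrow> fm \<Rightarrow> fm" where
  "literal v \<phi> = (if v \<phi> then \<phi> else Neg \<phi>)"

text \<open>Kalmar's lemma: by induction on the propositional structure, the literals true under
  \<open>v\<close> already derive the truth value of the whole formula.\<close>

lemma nd_literals:
  "wf_fm F \<phi> \<Longrightarrow> literal v ` prop_atoms \<phi> \<subseteq> \<Gamma> \<Longrightarrow>
    nd F T \<Gamma> (if pval v \<phi> then \<phi> else Neg \<phi>)"
proof (induction \<phi>)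
  case (Eq s t)
  then show ?case by (auto simp: literal_def intro: nd.Assm)
next
  case (Neg \<phi>)
  show ?case
  proof (cases "pval v \<phi>")
    case True
    have "nd F T \<Gamma> (Neg (Neg \<phi>))"
    proof (rule nd.NegI)
      show "wf_fm F (Neg \<phi>)" using Neg.prems by simp
      show "nd F T (insert (Neg \<phi>) \<Gamma>) \<phi>" using Neg True by (simp add: nd_insert)
      show "nd F T (insert (Neg \<phi>) \<Gamma>) (Neg \<phi>)" by (rule nd.Assm) simp
    qed
    with True show ?thesis by simp
  next
    case False
    then show ?thesis using Neg by auto
  qed
next
  case (Imp \<phi> \<psi>)
  have 1: "nd F T \<Gamma> (if pval v \<phi> then \<phi> else Neg \<phi>)" "nd F T \<Gamma> (if pval v \<psi> then \<psi> else Neg \<psi>)"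
    using Imp by (simp_all add: image_Un)
  have wf: "wf_fm F \<phi>" "wf_fm F \<psi>" using Imp.prems by auto
  have "nd F T \<Gamma> (Imp \<phi> \<psi>)" if "\<not> pval v \<phi>"
  proof (rule nd.ImpI[OF wf(1)], rule nd_explode[OF wf(2)])
    show "nd F T (insert \<phi> \<Gamma>) \<phi>" by (rule nd.Assm) simp
    show "nd F T (insert \<phi> \<Gamma>) (Neg \<phi>)" using 1 that by (simp add: nd_insert)
  qed
  moreover have "nd F T \<Gamma> (Imp \<phi> \<psi>)" if "pval v \<psi>"
    by (rule nd.ImpI[OF wf(1)]) (use 1 that in \<open>simp add: nd_insert\<close>)
  moreover have "nd F T \<Gamma> (Neg (Imp \<phi> \<psi>))" if "pval v \<phi>" "\<not> pval v \<psi>"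
  proof (rule nd.NegI)
    show "wf_fm F (Imp \<phi> \<psi>)" using wf by simp
    show "nd F T (insert (Imp \<phi> \<psi>) \<Gamma>) \<psi>"
      by (rule nd.ImpE[where \<phi> = \<phi>]) (use 1 that in \<open>simp_all add: nd.Assm nd_insert\<close>)
    show "nd F T (insert (Imp \<phi> \<psi>) \<Gamma>) (Neg \<psi>)"
      using 1 that by (simp add: nd_insert)
  qed
  ultimately show ?case by auto
next
  case (All \<phi>)
  then show ?case by (auto simp: literal_def intro: nd.Assm)
qed

text \<open>Two valuations that differ at a single atom give derivations from that atom and from its
  negation; \<open>nd_cases\<close> merges them, so the atoms can be discharged one after
  another.\<close>

lemma nd_eliminate_literals:
  assumes "finite A" "wf_fm F \<phi>" "\<And>\<psi>. \<psi> \<in> A \<Longrightarrow> wf_fm F \<psi>" "\<And>v. nd F T (literal v ` A) \<phi>"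
  shows "nd F T {} \<phi>"
  using assms(1,3,4)
proof (induction A rule: finite_induct)
  case (insert a A)
  have "nd F T (literal v ` A) \<phi>" for v
  proof (rule nd_cases)
    \<comment> \<open>The atom \<open>a\<close> is not in \<open>A\<close>, so its truth value can
      be set both ways without disturbing the other literals.\<close>
    have *: "literal (v(a := b)) ` A = literal v ` A" for b
      using insert.hyps by (auto simp: literal_def intro!: image_cong)
    show "nd F T (insert a (literal v ` A)) \<phi>"
      using insert.prems(2)[of "v(a := True)"] unfolding image_insert * by (simp add: literal_def)
    show "nd F T (insert (Neg a) (literal v ` A)) \<phi>"
      using insert.prems(2)[of "v(a := False)"] unfolding image_insert * by (simp add: literal_def)
  qed (use insert.prems assms(2) in auto)
  with insert show ?case by auto
qed auto

lemma wf_prop_atoms: "wf_fm F \<phi> \<Longrightarrow> \<psi> \<in> prop_atoms \<phi> \<Longrightarrow> wf_fm F \<psi>"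
  by (induction \<phi>) auto

lemma finite_prop_atoms: "finite (prop_atoms \<phi>)"
  by (induction \<phi>) auto

lemma nd_tautology:
  assumes "wf_fm F \<phi>" "\<And>v. pval v \<phi>"
  shows "nd F T {} \<phi>"
  by (rule nd_eliminate_literals[OF finite_prop_atoms[of \<phi>] assms(1)])
    (use assms wf_prop_atoms nd_literals[where \<phi> = \<phi>, OF assms(1) order_refl] in auto)

section \<open>Rules for theorems of a theory whose axioms are well formed\<close>

locale wf_theory =
  fixes F :: "fsym set" and T :: "fm set"
  assumes wf_axiom: "\<phi> \<in> T \<Longrightarrow> wf_fm F \<phi>"
begin

abbreviation prv :: "fm \<Rightarrow> bool" where "prv \<phi> \<equiv> proves F T \<phi>"
abbreviation wf :: "fm \<Rightarrow> bool" where "wf \<phi> \<equiv> wf_fm F \<phi>"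
abbreviation wft :: "tm \<Rightarrow> bool" where "wft t \<equiv> wf_tm F t"

lemma nd_wf: "nd F T \<Gamma> \<phi> \<Longrightarrow> (\<And>\<psi>. \<psi> \<in> \<Gamma> \<Longrightarrow> wf \<psi>) \<Longrightarrow> wf \<phi>"
proof (induction rule: nd.induct)
  case (AllI \<Gamma> \<phi>)
  have "wf \<phi>" by (rule AllI.IH) (auto simp: AllI.prems)
  then show ?case by simp
next
  case (AllE \<Gamma> \<phi> t)
  then show ?case by simp
next
  case (Leibniz \<phi> \<Gamma> s t)
  then show ?case by simp
qed (auto simp: wf_axiom)

lemma prv_wf: "prv \<phi> \<Longrightarrow> wf \<phi>"
  using nd_wf[of "{}"] by (simp add: proves_def)

lemma prv_MP: "prv (Imp \<phi> \<psi>) \<Longrightarrow> prv \<phi> \<Longrightarrow> prv \<psi>"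
  unfolding proves_def by (rule nd.ImpE)

lemma prv_prop0: "wf \<phi> \<Longrightarrow> (\<And>v. pval v \<phi>) \<Longrightarrow> prv \<phi>"
  unfolding proves_def by (rule nd_tautology)

text \<open>This and its variants carry out the propositional steps of the later proofs: they leave
  a truth table for \<open>pval\<close>, with equations and quantified formulas as atoms, and a
  check of well-formedness.\<close>

lemma prv_prop1:
  assumes "prv a" "wf \<phi>" "\<And>v. pval v a \<Longrightarrow> pval v \<phi>"
  shows "prv \<phi>"
  using prv_prop0[of "Imp a \<phi>"] prv_wf[of a] assms prv_MP by auto

lemma prv_prop2:
  assumes "prv a" "prv b" "wf \<phi>" "\<And>v. pval v a \<Longrightarrow> pval v b \<Longrightarrow> pval v \<phi>"
  shows "prv \<phi>"
  using prv_prop1[of a "Imp b \<phi>"] prv_wf[of b] assms prv_MP by auto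

lemma prv_prop3:
  assumes "prv a" "prv b" "prv c" "wf \<phi>"
    "\<And>v. pval v a \<Longrightarrow> pval v b \<Longrightarrow> pval v c \<Longrightarrow> pval v \<phi>"
  shows "prv \<phi>"
  using prv_prop2[of a b "Imp c \<phi>"] prv_wf[of c] assms prv_MP by auto

lemma prv_gen: "prv \<phi> \<Longrightarrow> prv (All \<phi>)"
  unfolding proves_def by (rule nd.AllI) simp

lemma prv_All_inst: "wf \<phi> \<Longrightarrow> wft t \<Longrightarrow> prv (Imp (All \<phi>) (inst \<phi> t))"
  unfolding proves_def by (rule nd.ImpI) (auto intro: nd.AllE nd.Assm)

text \<open>The lift on \<open>\<psi>\<close> is the de Bruijn form of the side condition that the
  generalized variable is not free in it.\<close>

lemma prv_All_mono:
  assumes "prv (Imp (lift_fm \<psi>) \<phi>)" "wf \<psi>"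
  shows "prv (Imp \<psi> (All \<phi>))"
  unfolding proves_def
proof (intro nd.ImpI nd.AllI assms(2))
  have "nd F T {lift_fm \<psi>} (Imp (lift_fm \<psi>) \<phi>)"
    using assms(1) unfolding proves_def by (rule nd_mono) simp
  then show "nd F T (lift_fm ` {\<psi>}) \<phi>" by (auto intro: nd.ImpE nd.Assm)
qed

lemma prv_Exi_inst: "wf \<phi> \<Longrightarrow> wft t \<Longrightarrow> prv (Imp (inst \<phi> t) (Exi \<phi>))"
  using prv_All_inst[of "Neg \<phi>" t]
  by (rule prv_prop1) auto

lemma prv_Exi_elim:
  assumes "prv (Imp \<phi> (lift_fm \<psi>))" "wf \<psi>"
  shows "prv (Imp (Exi \<phi>) \<psi>)"
proof -
  have wf: "wf \<phi>" using prv_wf[OF assms(1)] by simp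
  have "prv (Imp (lift_fm (Neg \<psi>)) (Neg \<phi>))"
    by (rule prv_prop1[OF assms(1)]) (use assms wf in auto)
  then have "prv (Imp (Neg \<psi>) (All (Neg \<phi>)))"
    by (rule prv_All_mono) (use assms(2) in simp)
  then show ?thesis by (rule prv_prop1) (use assms(2) wf in auto)
qed

text \<open>Elimination of a quantifier handles one variable at a time. Enough generalizations bind
  all free variables, and eliminating the quantifiers again with the terms \<open>\<sigma> i\<close>
  amounts to the simultaneous substitution.\<close>

lemma prv_subst:
  assumes "prv \<phi>" "\<And>i. wft (\<sigma> i)"
  shows "prv (subst_fm \<sigma> \<phi>)"
proof -
  \<comment> \<open>Each instantiation shifts the remaining variables down by one, hence
    \<open>i - n\<close> for variables that none of the \<open>n\<close> quantifiers binds. The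
    induction removes the outer quantifiers first and the innermost last.\<close>
  have *: "prv ((All ^^ n) \<psi>) \<Longrightarrow> (\<And>i. wft (\<sigma> i)) \<Longrightarrow>
      prv (subst_fm (\<lambda>i. if i < n then \<sigma> i else Var (i - n)) \<psi>)" for n \<sigma> \<psi>
  proof (induction n arbitrary: \<sigma> \<psi>)
    case (Suc n)
    let ?\<tau> = "\<lambda>i. if i < n then \<sigma> (Suc i) else Var (i - n)"
    have "prv (subst_fm ?\<tau> (All \<psi>))"
      by (rule Suc.IH) (use Suc.prems in \<open>auto simp: funpow_swap1\<close>)
    then have "prv (inst (subst_fm (case_nat (Var 0) (\<lambda>n. lift_tm (?\<tau> n))) \<psi>) (\<sigma> 0))"
      unfolding proves_def by (auto intro: nd.AllE Suc.prems)
    moreover have "case_nat (\<sigma> 0) ?\<tau> = (\<lambda>i. if i < Suc n then \<sigma> i else Var (i - Suc n))"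
      by (auto simp: fun_eq_iff split: nat.split)
    ultimately show ?case by (simp only: inst_subst_fm)
  qed simp
  have gen: "prv ((All ^^ n) \<phi>)" for n
    by (induction n) (auto intro: prv_gen assms)
  obtain n where "\<forall>i\<in>fv_fm \<phi>. i < n"
    using finite_fv_fm finite_nat_set_iff_bounded by metis
  then have "subst_fm (\<lambda>i. if i < n then \<sigma> i else Var (i - n)) \<phi> = subst_fm \<sigma> \<phi>"
    by (intro subst_fm_cong) auto
  moreover have "prv (subst_fm (\<lambda>i. if i < n then \<sigma> i else Var (i - n)) \<phi>)"
    using gen assms(2) by (rule *)
  ultimately show ?thesis by simp
qed

section \<open>Equality and congruence\<close>

lemma prv_refl: "wft t \<Longrightarrow> prv (Eq t t)"
  unfolding proves_def by (rule nd.Refl)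

lemma prv_Leibniz:
  assumes "wf \<phi>" "wft s" "wft t"
  shows "prv (Imp (Eq s t) (Imp (inst \<phi> s) (inst \<phi> t)))"
  unfolding proves_def
  by (intro nd.ImpI nd.Leibniz[where \<phi> = \<phi> and s = s and t = t])
    (use assms in \<open>auto intro: nd.Assm\<close>)

text \<open>Leibniz for the formula \<open>x = s\<close>, whose instance at \<open>s\<close> is
  reflexivity. Transitivity and congruence likewise come from a suitable choice of the
  formula.\<close>

lemma prv_sym_imp:
  assumes "wft s" "wft t"
  shows "prv (Imp (Eq s t) (Eq t s))"
  using prv_Leibniz[of "Eq (Var 0) (lift_tm s)" s t] prv_refl[of s]
  by (rule prv_prop2) (use assms in auto)

lemma prv_trans_imp:
  assumes "wft r" "wft s" "wft t"
  shows "prv (Imp (Eq r s) (Imp (Eq s t) (Eq r t)))"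
  using prv_Leibniz[of "Eq (lift_tm r) (Var 0)" s t]
  by (rule prv_prop1) (use assms in auto)

lemma prv_cong_imp:
  assumes "wft c" "wft s" "wft t"
  shows "prv (Imp (Eq s t) (Eq (subst_tm (case_nat s Var) c) (subst_tm (case_nat t Var) c)))"
  using prv_Leibniz[of "Eq (lift_tm (subst_tm (case_nat s Var) c)) c" s t]
    prv_refl[of "subst_tm (case_nat s Var) c"]
  by (rule prv_prop2) (use assms in auto)

lemma prv_sym: "prv (Eq s t) \<Longrightarrow> prv (Eq t s)"
  using prv_wf[of "Eq s t"] prv_MP[OF prv_sym_imp] by simp

lemma prv_trans [trans]: "prv (Eq r s) \<Longrightarrow> prv (Eq s t) \<Longrightarrow> prv (Eq r t)"
  using prv_wf[of "Eq r s"] prv_wf[of "Eq s t"] prv_MP[OF prv_MP[OF prv_trans_imp], of r s t] by simp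

lemma prv_Succ_cong: "prv (Eq s t) \<Longrightarrow> prv (Eq (Succ s) (Succ t))"
  using prv_wf[of "Eq s t"] prv_MP[OF prv_cong_imp[of "Succ (Var 0)" s t]] by simp

lemma prv_Plus_cong:
  assumes "prv (Eq s s')" "prv (Eq t t')"
  shows "prv (Eq (Plus s t) (Plus s' t'))"
proof -
  have wf: "wft s" "wft s'" "wft t" "wft t'" using assms[THEN prv_wf] by auto
  have "prv (Eq (Plus s t) (Plus s' t))"
    using prv_MP[OF prv_cong_imp[of "Plus (Var 0) (lift_tm t)" s s'] assms(1)] wf
    by simp
  also have "prv (Eq (Plus s' t) (Plus s' t'))"
    using prv_MP[OF prv_cong_imp[of "Plus (lift_tm s') (Var 0)" t t'] assms(2)] wf
    by simp
  finally show ?thesis .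
qed

lemma prv_Times_cong:
  assumes "prv (Eq s s')" "prv (Eq t t')"
  shows "prv (Eq (Times s t) (Times s' t'))"
proof -
  have wf: "wft s" "wft s'" "wft t" "wft t'" using assms[THEN prv_wf] by auto
  have "prv (Eq (Times s t) (Times s' t))"
    using prv_MP[OF prv_cong_imp[of "Times (Var 0) (lift_tm t)" s s'] assms(1)] wf
    by simp
  also have "prv (Eq (Times s' t) (Times s' t'))"
    using prv_MP[OF prv_cong_imp[of "Times (lift_tm s') (Var 0)" t t'] assms(2)] wf
    by simp
  finally show ?thesis .
qed

lemma prv_App_cong:
  assumes "f \<in> F" "length ts = arity f" "list_all2 (\<lambda>s t. prv (Eq s t)) ss ts"
  shows "prv (Eq (App f ss) (App f ts))"
proof -
  \<comment> \<open>The arguments are replaced from left to right; the prefix \<open>rs\<close>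
    holds those already replaced.\<close>
  have "list_all2 (\<lambda>s t. prv (Eq s t)) ss ts \<Longrightarrow> list_all wft rs \<Longrightarrow> length (rs @ ts) = arity f \<Longrightarrow>
      prv (Eq (App f (rs @ ss)) (App f (rs @ ts)))" for rs
  proof (induction arbitrary: rs rule: list_all2_induct)
    case Nil
    then show ?case using assms(1) by (auto intro!: prv_refl)
  next
    case (Cons s ss t ts)
    have wf: "wft s" "wft t" using prv_wf[OF Cons.hyps(1)] by auto
    have "list_all2 (\<lambda>s t. wft s) ss ts"
      using Cons.hyps(2) by (rule list_all2_mono) (auto dest: prv_wf)
    then have ss: "list_all wft ss" "length ss = length ts"
      by (auto simp: list_all2_conv_all_nth list_all_length)
    let ?c = "App f (map lift_tm rs @ Var 0 # map lift_tm ss)"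
    have "wft ?c"
      using assms(1) Cons.prems ss by (auto simp: list_all_iff)
    from prv_MP[OF prv_cong_imp[OF this wf] Cons.hyps(1)]
    have "prv (Eq (App f (rs @ s # ss)) (App f (rs @ t # ss)))"
      by (simp add: comp_def)
    also have "prv (Eq (App f (rs @ t # ss)) (App f (rs @ t # ts)))"
      using Cons.IH[of "rs @ [t]"] Cons.prems wf by simp
    finally show ?case .
  qed
  from this[of "[]"] assms show ?thesis by simp
qed

end

section \<open>Arithmetic inside PA\<close>

locale peano =
  fixes F :: "fsym set"
  assumes language: "pr_language F"

sublocale peano \<subseteq> wf_theory F "PA F"
  by unfold_locales (rule wf_PA[OF language])

context peano
begin

lemma prv_ax: "\<phi> \<in> PA F \<Longrightarrow> (\<And>i. wft (\<sigma> i)) \<Longrightarrow> prv (subst_fm \<sigma> \<phi>)"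
  by (rule prv_subst) (auto simp: proves_def intro: nd.Ax)

lemma prv_Succ_neq_Zero: "wft t \<Longrightarrow> prv (Neg (Eq (Succ t) Zero))"
  using prv_ax[OF PA.succ_neq_zero, of "\<lambda>_. t"] by simp

lemma prv_Succ_inj: "wft s \<Longrightarrow> wft t \<Longrightarrow> prv (Imp (Eq (Succ s) (Succ t)) (Eq s t))"
  using prv_ax[OF PA.succ_inj, of "\<lambda>i. if i = 0 then s else t"] by simp

lemma prv_Plus_Zero: "wft t \<Longrightarrow> prv (Eq (Plus t Zero) t)"
  using prv_ax[OF PA.plus_zero, of "\<lambda>_. t"] by simp

lemma prv_Plus_Succ: "wft s \<Longrightarrow> wft t \<Longrightarrow> prv (Eq (Plus s (Succ t)) (Succ (Plus s t)))"
  using prv_ax[OF PA.plus_succ, of "\<lambda>i. if i = 0 then s else t"] by simp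

lemma prv_Times_Zero: "wft t \<Longrightarrow> prv (Eq (Times t Zero) Zero)"
  using prv_ax[OF PA.times_zero, of "\<lambda>_. t"] by simp

lemma prv_Times_Succ: "wft s \<Longrightarrow> wft t \<Longrightarrow> prv (Eq (Times s (Succ t)) (Plus (Times s t) s))"
  using prv_ax[OF PA.times_succ, of "\<lambda>i. if i = 0 then s else t"] by simp

text \<open>Instantiation lowers the parameters, so the quantified formula is lifted first; lifting
  and then instantiating at variable 0 gives back \<open>\<phi>\<close>.\<close>

lemma prv_spec:
  assumes "prv (All \<phi>)"
  shows "prv \<phi>"
proof -
  have "prv (lift_fm (All \<phi>))" using assms by (rule prv_subst) simp
  then have "prv (inst (subst_fm (case_nat (Var 0) (\<lambda>n. lift_tm (Var (Suc n)))) \<phi>) (Var 0))"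
    unfolding proves_def by (auto intro: nd.AllE)
  then have "prv (subst_fm (case_nat (Var 0) (\<lambda>n. Var (Suc n))) \<phi>)"
    by (simp only: inst_subst_fm)
  moreover have "subst_fm (case_nat (Var 0) (\<lambda>n. Var (Suc n))) \<phi> = \<phi>"
    by (rule subst_fm_id) (simp split: nat.split)
  ultimately show ?thesis by simp
qed

lemma prv_induct:
  assumes "prv (plug \<phi> Zero)" "prv (Imp \<phi> (plug \<phi> (Succ (Var 0))))"
  shows "prv \<phi>"
proof -
  have "wf \<phi>" using prv_wf[OF assms(2)] by simp
  then have ax: "prv (Imp (inst \<phi> Zero) (Imp (All (Imp \<phi> (plug \<phi> (Succ (Var 0))))) (All \<phi>)))"
    unfolding proves_def by (intro nd.Ax PA.induct_ax)
  \<comment> \<open>The base case of the axiom is an \<open>inst\<close>, which lowers the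
    parameters, whereas \<open>plug\<close> keeps them. After plugging in zero no variable 0 is
    left, so all indices can be lowered by one.\<close>
  have "prv (subst_fm (\<lambda>i. Var (i - 1)) (plug \<phi> Zero))"
    using assms(1) by (rule prv_subst) simp
  moreover have "subst_fm (\<lambda>i. Var (i - 1)) (plug \<phi> Zero) = inst \<phi> Zero"
    unfolding subst_fm_subst_fm by (rule subst_fm_cong) (simp split: nat.split)
  ultimately have "prv (inst \<phi> Zero)" by simp
  from prv_MP[OF prv_MP[OF ax this] prv_gen[OF assms(2)]] show ?thesis
    by (rule prv_spec)
qed

text \<open>Case distinction between zero and successors is induction whose step ignores the
  induction hypothesis.\<close>

lemma prv_cases:
  assumes "prv (plug \<phi> Zero)" "prv (plug \<phi> (Succ (Var 0)))" "wf \<phi>"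
  shows "prv \<phi>"
  using assms(1)
  by (rule prv_induct) (rule prv_prop1[OF assms(2)], use assms(3) in auto)

lemma prv_imp_trans:
  assumes "prv (Eq r s)" "prv (Imp \<phi> (Eq s t))"
  shows "prv (Imp \<phi> (Eq r t))"
proof -
  have "wft r" "wft s" "wft t" "wf \<phi>" using assms[THEN prv_wf] by auto
  then show ?thesis by (intro prv_prop3[OF assms prv_trans_imp[of r s t]]) auto
qed

lemma prv_imp_Succ_cong:
  assumes "prv (Imp \<phi> (Eq s t))"
  shows "prv (Imp \<phi> (Eq (Succ s) (Succ t)))"
proof -
  have "wft s" "wft t" "wf \<phi>" using prv_wf[OF assms] by auto
  then show ?thesis
    by (intro prv_prop2[OF assms prv_cong_imp[of "Succ (Var 0)" s t]]) auto
qed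

lemma prv_Zero_Plus:
  assumes "wft t"
  shows "prv (Eq (Plus Zero t) t)"
proof -
  let ?\<phi> = "Eq (Plus Zero (Var 0)) (Var 0)"
  have "prv ?\<phi>"
  proof (rule prv_induct)
    show "prv (plug ?\<phi> Zero)" by (simp add: prv_Plus_Zero)
    have "prv (Imp ?\<phi> (Eq (Plus Zero (Succ (Var 0))) (Succ (Var 0))))"
      by (rule prv_imp_trans[OF prv_Plus_Succ prv_imp_Succ_cong]) (auto intro: prv_prop0)
    then show "prv (Imp ?\<phi> (plug ?\<phi> (Succ (Var 0))))" by simp
  qed
  from prv_subst[OF this, of "\<lambda>_. t"] assms show ?thesis by simp
qed

text \<open>Addition recurses on the right, so a successor on the left takes an induction on the
  right argument. It is done for two variables, which are then replaced by the terms.\<close>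

lemma prv_Succ_Plus:
  assumes "wft s" "wft t"
  shows "prv (Eq (Plus (Succ s) t) (Succ (Plus s t)))"
proof -
  let ?x = "Var 0" and ?y = "Var 1"
  let ?\<phi> = "Eq (Plus (Succ ?y) ?x) (Succ (Plus ?y ?x))"
  have "prv ?\<phi>"
  proof (rule prv_induct)
    have "prv (Eq (Plus (Succ ?y) Zero) (Succ ?y))" by (simp add: prv_Plus_Zero)
    also have "prv (Eq (Succ ?y) (Succ (Plus ?y Zero)))"
      by (intro prv_Succ_cong prv_sym[OF prv_Plus_Zero]) simp
    finally show "prv (plug ?\<phi> Zero)" by simp
    have "prv (Imp ?\<phi> (Eq (Plus (Succ ?y) ?x) (Plus ?y (Succ ?x))))"
    proof (rule prv_prop2)
      show "prv (Imp ?\<phi> (Imp (Eq (Succ (Plus ?y ?x)) (Plus ?y (Succ ?x)))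
          (Eq (Plus (Succ ?y) ?x) (Plus ?y (Succ ?x)))))"
        by (rule prv_trans_imp) auto
      show "prv (Eq (Succ (Plus ?y ?x)) (Plus ?y (Succ ?x)))"
        by (rule prv_sym[OF prv_Plus_Succ]) auto
    qed auto
    then have "prv (Imp ?\<phi> (Eq (Plus (Succ ?y) (Succ ?x)) (Succ (Plus ?y (Succ ?x)))))"
      by (intro prv_imp_trans[OF prv_Plus_Succ prv_imp_Succ_cong]) auto
    then show "prv (Imp ?\<phi> (plug ?\<phi> (Succ ?x)))" by simp
  qed
  from prv_subst[OF this, of "\<lambda>i. if i = 0 then t else s"] assms show ?thesis by simp
qed

section \<open>Computation with numerals\<close>

lemma prv_nml_neq: "m \<noteq> n \<Longrightarrow> prv (Neg (Eq (nml m) (nml n)))"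
proof (induction m arbitrary: n)
  case 0
  then obtain n' where n: "n = Suc n'" by (cases n) auto
  have "prv (Imp (Eq Zero (nml n)) (Eq (nml n) Zero))" by (rule prv_sym_imp) auto
  moreover have "prv (Neg (Eq (nml n) Zero))" by (simp add: n prv_Succ_neq_Zero)
  ultimately show ?case by (rule prv_prop2) auto
next
  case (Suc m)
  show ?case
  proof (cases n)
    case 0
    then show ?thesis by (simp add: prv_Succ_neq_Zero)
  next
    case (Suc n')
    then have "prv (Neg (Eq (nml m) (nml n')))" using Suc.prems Suc.IH by simp
    moreover have "prv (Imp (Eq (nml (Suc m)) (nml (Suc n'))) (Eq (nml m) (nml n')))"
      by (simp add: prv_Succ_inj)
    ultimately have "prv (Neg (Eq (nml (Suc m)) (nml (Suc n'))))" by (rule prv_prop2) auto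
    with Suc show ?thesis by simp
  qed
qed

lemma prv_Plus_nml: "prv (Eq (Plus (nml m) (nml n)) (nml (m + n)))"
proof (induction n)
  case 0
  then show ?case by (simp add: prv_Plus_Zero)
next
  case (Suc n)
  have "prv (Eq (Plus (nml m) (Succ (nml n))) (Succ (Plus (nml m) (nml n))))"
    by (rule prv_Plus_Succ) auto
  also note prv_Succ_cong[OF Suc]
  finally show ?case by simp
qed

lemma prv_Times_nml: "prv (Eq (Times (nml m) (nml n)) (nml (m * n)))"
proof (induction n)
  case 0
  then show ?case by (simp add: prv_Times_Zero)
next
  case (Suc n)
  have "prv (Eq (Times (nml m) (Succ (nml n))) (Plus (Times (nml m) (nml n)) (nml m)))"
    by (rule prv_Times_Succ) auto
  also have "prv (Eq (Plus (Times (nml m) (nml n)) (nml m)) (Plus (nml (m * n)) (nml m)))"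
    by (rule prv_Plus_cong[OF Suc prv_refl]) simp
  also note prv_Plus_nml
  finally show ?case by (simp add: add.commute)
qed

text \<open>An induction on the recursion argument \<open>a\<close>; the assumptions on
  \<open>t\<close> and \<open>u\<close> are the induction hypotheses available inside
  \<open>prv_eval\<close>.\<close>

lemma prv_eval_PrimRec:
  assumes f: "PrimRec k t u \<in> F" (is "?f \<in> F") and "length as = k"
    and t: "\<And>e. prv (Eq (subst_tm (\<lambda>i. nml (e i)) t) (nml (eval_tm t e)))"
    and u: "\<And>e. prv (Eq (subst_tm (\<lambda>i. nml (e i)) u) (nml (eval_tm u e)))"
  shows "prv (Eq (App ?f (map nml (a # as))) (nml (eval_fsym ?f (a # as))))"
proof (induction a)
  case 0
  let ?\<sigma> = "\<lambda>i. if i < k then nml (as ! i) else Zero"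
  have "prv (subst_fm ?\<sigma> (Eq (App ?f (Zero # map Var [0..<k])) t))"
    by (rule prv_ax[OF PA.pr_zero[OF f]]) simp
  moreover have "subst_tm ?\<sigma> t = subst_tm (\<lambda>i. nml (as ! i)) t"
    by (rule subst_tm_cong) (use pr_languageD[OF language f] in auto)
  moreover have "map (subst_tm ?\<sigma> \<circ> Var) [0..<k] = map nml as"
    by (rule nth_equalityI) (auto simp: assms(2))
  ultimately have "prv (Eq (App ?f (Zero # map nml as)) (subst_tm (\<lambda>i. nml (as ! i)) t))"
    by simp
  also note t
  finally show ?case by simp
next
  case (Suc a)
  let ?r = "eval_fsym ?f (a # as)"
  let ?\<sigma> = "\<lambda>i. if i < Suc k then nml ((a # as) ! i) else Zero"
  \<comment> \<open>Here only the place of the recursive value is left open, so that the congruence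
    rule can replace the application at \<open>a\<close> by its computed numeral.\<close>
  let ?c = "subst_tm (case_nat (Var 0) ?\<sigma>) u"
  have "prv (subst_fm ?\<sigma> (Eq (App ?f (Succ (Var 0) # map Var [1..<Suc k]))
      (subst_tm (case_nat (App ?f (map Var [0..<Suc k])) Var) u)))"
    by (rule prv_ax[OF PA.pr_succ[OF f]]) simp
  moreover have "map (subst_tm ?\<sigma> \<circ> Var) [1..<Suc k] = map nml as"
    by (rule nth_equalityI) (auto simp: assms(2) simp del: upt_Suc)
  moreover have "map (subst_tm ?\<sigma> \<circ> Var) [0..<Suc k] = map nml (a # as)"
    by (rule nth_equalityI) (auto simp: assms(2) nth_Cons' simp del: upt_Suc)
  moreover have "subst_tm ?\<sigma> (subst_tm (case_nat (App ?f (map Var [0..<Suc k])) Var) u)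
      = subst_tm (case_nat (App ?f (map (subst_tm ?\<sigma> \<circ> Var) [0..<Suc k])) ?\<sigma>) u"
    unfolding subst_tm_subst_tm by (rule subst_tm_cong) (simp split: nat.split del: upt_Suc)
  ultimately have "prv (Eq (App ?f (map nml (Suc a # as)))
      (subst_tm (case_nat (App ?f (map nml (a # as))) ?\<sigma>) u))"
    by (simp del: upt_Suc)
  also have "prv (Eq (subst_tm (case_nat (App ?f (map nml (a # as))) ?\<sigma>) u)
      (subst_tm (case_nat (nml ?r) ?\<sigma>) u))"
  proof -
    have c: "subst_tm (case_nat s Var) ?c = subst_tm (case_nat s ?\<sigma>) u" for s
      unfolding subst_tm_subst_tm by (rule subst_tm_cong) (simp split: nat.split)
    have "wft ?c"
      by (rule wf_tm_subst) (use pr_languageD[OF language f] in \<open>auto split: nat.split\<close>)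
    moreover have "wft (App ?f (map nml (a # as)))"
      using prv_wf[OF Suc] by simp
    ultimately show ?thesis
      using prv_MP[OF prv_cong_imp[of ?c "App ?f (map nml (a # as))" "nml ?r"] Suc]
      unfolding c by simp
  qed
  also have "subst_tm (case_nat (nml ?r) ?\<sigma>) u = subst_tm (\<lambda>i. nml ((?r # a # as) ! i)) u"
    by (rule subst_tm_cong)
      (use pr_languageD(4)[OF language f] in \<open>force split: nat.split simp: nth_Cons\<close>)
  also note u
  finally show ?case by simp
qed

text \<open>The terms defining a function symbol are structural parts of it, so a simultaneous
  induction on terms and symbols reaches them.\<close>

lemma prv_eval:
  "wft t \<Longrightarrow> prv (Eq (subst_tm (\<lambda>i. nml (e i)) t) (nml (eval_tm t e)))"
  and prv_eval_fsym:
  "f \<in> F \<Longrightarrow> length as = arity f \<Longrightarrow> prv (Eq (App f (map nml as)) (nml (eval_fsym f as)))"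
proof (induction t and f arbitrary: e and as)
  case (Var x)
  then show ?case by (simp add: prv_refl)
next
  case Zero
  then show ?case by (simp add: prv_refl)
next
  case (Succ t)
  then show ?case by (simp add: prv_Succ_cong)
next
  case (Plus s t)
  then show ?case using prv_trans[OF prv_Plus_cong prv_Plus_nml] by simp
next
  case (Times s t)
  then show ?case using prv_trans[OF prv_Times_cong prv_Times_nml] by simp
next
  case (App f ts)
  let ?as = "map (\<lambda>t. eval_tm t e) ts"
  have "list_all2 (\<lambda>s t. prv (Eq s t)) (map (subst_tm (\<lambda>i. nml (e i))) ts) (map nml ?as)"
    using App.prems App.IH(2) by (auto simp: list_all2_conv_all_nth list_all_length)
  then have "prv (Eq (App f (map (subst_tm (\<lambda>i. nml (e i))) ts)) (App f (map nml ?as)))"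
    using App.prems by (intro prv_App_cong) auto
  also have "prv (Eq (App f (map nml ?as)) (nml (eval_fsym f ?as)))"
    using App.prems by (intro App.IH(1)) auto
  finally show ?case by simp
next
  case (PrimRec k t u)
  obtain a bs where as: "as = a # bs" "length bs = k"
    using PrimRec.prems(2) by (cases as) auto
  show ?case
    unfolding as(1)
    by (rule prv_eval_PrimRec)
      (use PrimRec as pr_languageD[OF language PrimRec.prems(1)] in auto)
qed

section \<open>The order, and case distinctions up to a numeral\<close>

lemma prv_Less_intro:
  assumes "wft s" "wft r" "wft t"
  shows "prv (Imp (Eq (Plus s (Succ r)) t) (Less s t))"
  using prv_Exi_inst[of "Eq (Plus (lift_tm s) (Succ (Var 0))) (lift_tm t)" r] assms by simp

lemma prv_not_Less_Zero:
  assumes "wft t"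
  shows "prv (Neg (Less t Zero))"
proof -
  let ?s = "Plus (lift_tm t) (Succ (Var 0))"
  have "prv (Imp (Eq ?s Zero) (Eq (Succ (Plus (lift_tm t) (Var 0))) Zero))"
    by (rule prv_imp_trans[OF prv_sym[OF prv_Plus_Succ]]) (use assms in \<open>auto intro: prv_prop0\<close>)
  moreover have "prv (Neg (Eq (Succ (Plus (lift_tm t) (Var 0))) Zero))"
    by (rule prv_Succ_neq_Zero) (use assms in auto)
  \<comment> \<open>\<open>Neg (Eq Zero Zero)\<close> serves as falsum: it has no free variables, so
    it may be the conclusion of an existential elimination.\<close>
  ultimately have "prv (Imp (Eq ?s Zero) (lift_fm (Neg (Eq Zero Zero))))"
    by (rule prv_prop2) (use assms in auto)
  then have "prv (Imp (Exi (Eq ?s Zero)) (Neg (Eq Zero Zero)))"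
    by (rule prv_Exi_elim) simp
  moreover have "prv (Eq Zero Zero)" by (rule prv_refl) simp
  ultimately show ?thesis by (rule prv_prop2) (use assms in auto)
qed

lemma prv_Less_Succ_Succ:
  assumes "wft s" "wft t"
  shows "prv (Imp (Less (Succ s) (Succ t)) (Less s t))"
proof -
  let ?s = "lift_tm s" and ?t = "lift_tm t" and ?z = "Succ (Var 0)"
  have "prv (Imp (Eq (Plus (Succ ?s) ?z) (Succ ?t)) (Eq (Succ (Plus ?s ?z)) (Succ ?t)))"
    by (rule prv_imp_trans[OF prv_sym[OF prv_Succ_Plus]]) (use assms in \<open>auto intro: prv_prop0\<close>)
  moreover have "prv (Imp (Eq (Succ (Plus ?s ?z)) (Succ ?t)) (Eq (Plus ?s ?z) ?t))"
    by (rule prv_Succ_inj) (use assms in auto)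
  moreover have "prv (Imp (Eq (Plus ?s ?z) ?t) (Less ?s ?t))"
    by (rule prv_Less_intro) (use assms in auto)
  ultimately have "prv (Imp (Eq (Plus (Succ ?s) ?z) (Succ ?t)) (Less ?s ?t))"
    by (rule prv_prop3) (use assms in auto)
  then have "prv (Imp (Eq (Plus (Succ ?s) ?z) (Succ ?t)) (lift_fm (Less s t)))"
    by (simp only: subst_fm_Less)
  then have "prv (Imp (Exi (Eq (Plus (Succ ?s) ?z) (Succ ?t))) (Less s t))"
    by (rule prv_Exi_elim) (use assms in auto)
  then show ?thesis by simp
qed

text \<open>By splitting variable 0 into zero and a successor: below a successor bound the
  predecessor lies below the smaller bound, where the induction hypothesis applies to
  \<open>\<psi>\<close> at the successor.\<close>

lemma prv_Less_nml_imp: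
  assumes "wf \<psi>" "\<And>m. m < n \<Longrightarrow> prv (plug \<psi> (nml m))"
  shows "prv (Imp (Less (Var 0) (nml n)) \<psi>)"
  using assms
proof (induction n arbitrary: \<psi>)
  case 0
  have "prv (Neg (Less (Var 0) (nml 0)))" unfolding nml_0 by (rule prv_not_Less_Zero) simp
  then show ?case by (rule prv_prop1) (use 0 in auto)
next
  case (Suc n)
  let ?\<chi> = "Imp (Less (Var 0) (nml (Suc n))) \<psi>" and ?\<psi> = "plug \<psi> (Succ (Var 0))"
  show ?case
  proof (rule prv_cases)
    have "prv (plug \<psi> Zero)" using Suc.prems(2)[of 0] by (simp del: fun_upd_apply)
    then show "prv (plug ?\<chi> Zero)" by (rule prv_prop1) (use Suc.prems(1) in auto)
    have "plug ?\<psi> (nml m) = plug \<psi> (nml (Suc m))" for m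
      unfolding subst_fm_subst_fm by (rule subst_fm_cong) simp
    then have "prv (plug ?\<psi> (nml m))" if "m < n" for m
      using Suc.prems(2)[of "Suc m"] that by (simp only: Suc_less_eq)
    then have "prv (Imp (Less (Var 0) (nml n)) ?\<psi>)"
      by (intro Suc.IH wf_fm_plug Suc.prems(1)) (assumption | simp)+
    moreover have "prv (Imp (Less (Succ (Var 0)) (Succ (nml n))) (Less (Var 0) (nml n)))"
      by (rule prv_Less_Succ_Succ) auto
    ultimately have "prv (Imp (Less (Succ (Var 0)) (Succ (nml n))) ?\<psi>)"
      by (rule prv_prop2) (use Suc.prems(1) in auto)
    then show "prv (plug ?\<chi> (Succ (Var 0)))" by simp
    show "wf ?\<chi>" using Suc.prems(1) by simp
  qed
qed

text \<open>Splitting into zero and successor \<open>n\<close> times leaves the numerals below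
  \<open>n\<close> and the numbers that are an \<open>n\<close>-fold successor.\<close>

lemma prv_finite_cases:
  assumes "wf \<psi>" "\<And>m. m < n \<Longrightarrow> prv (plug \<psi> (nml m))" "prv (plug \<psi> ((Succ ^^ n) (Var 0)))"
  shows "prv \<psi>"
  using assms
proof (induction n arbitrary: \<psi>)
  case 0
  have "plug \<psi> (Var 0) = \<psi>" by (rule subst_fm_id) simp
  with 0 show ?case by simp
next
  case (Suc n)
  let ?\<psi> = "plug \<psi> (Succ (Var 0))"
  have plug: "plug ?\<psi> t = plug \<psi> (Succ t)" for t
    unfolding subst_fm_subst_fm by (rule subst_fm_cong) simp
  have 1: "prv ?\<psi>"
  proof (rule Suc.IH)
    show "wf ?\<psi>" using Suc.prems(1) by simp
    show "prv (plug ?\<psi> (nml m))" if "m < n" for m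
      unfolding plug using Suc.prems(2)[of "Suc m"] that by (simp del: fun_upd_apply)
    show "prv (plug ?\<psi> ((Succ ^^ n) (Var 0)))"
      unfolding plug using Suc.prems(3) by (simp del: fun_upd_apply)
  qed
  have "prv (plug \<psi> Zero)" using Suc.prems(2)[of 0] by (simp del: fun_upd_apply)
  then show ?case using 1 Suc.prems(1) by (rule prv_cases)
qed

lemma wft_Succ_pow [simp]: "wft ((Succ ^^ n) t) \<longleftrightarrow> wft t"
  by (induction n) auto

lemma prv_nml_Less_Succ_pow:
  assumes "wft t"
  shows "prv (Less (nml n) ((Succ ^^ Suc n) t))"
proof -
  have "prv (Eq (Plus (nml n) (Succ t)) ((Succ ^^ Suc n) t))"
  proof (induction n)
    case 0
    then show ?case using assms by (simp add: prv_Zero_Plus)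
  next
    case (Suc n)
    have "prv (Eq (Plus (Succ (nml n)) (Succ t)) (Succ (Plus (nml n) (Succ t))))"
      by (rule prv_Succ_Plus) (use assms in auto)
    also note prv_Succ_cong[OF Suc]
    finally show ?case by simp
  qed
  with prv_Less_intro[of "nml n" t "(Succ ^^ Suc n) t"] assms show ?thesis
    by (auto intro: prv_MP)
qed

end

section \<open>Sigma-one completeness\<close>

context peano
begin

abbreviation num_subst :: "(nat \<Rightarrow> nat) \<Rightarrow> fm \<Rightarrow> fm" where
  "num_subst e \<equiv> subst_fm (\<lambda>i. nml (e i))"

text \<open>Refuting false instances is demanded along with proving true ones, so that the property
  passes through negation.\<close>

definition decides :: "fm \<Rightarrow> bool" where
  "decides \<phi> \<longleftrightarrow> (\<forall>e. (sat \<phi> e \<longrightarrow> prv (num_subst e \<phi>)) \<and>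
     (\<not> sat \<phi> e \<longrightarrow> prv (Neg (num_subst e \<phi>))))"

lemma wf_num_subst [simp]: "wf \<phi> \<Longrightarrow> wf (num_subst e \<phi>)"
  by (rule wf_fm_subst) simp_all

lemma wf_num_subst_up [simp]: "wf \<phi> \<Longrightarrow> wf (subst_fm (case_nat (Var 0) (\<lambda>i. nml (e i))) \<phi>)"
  by (rule wf_fm_subst) (simp_all split: nat.split)

lemma num_subst_All:
  "num_subst e (All \<phi>) = All (subst_fm (case_nat (Var 0) (\<lambda>i. nml (e i))) \<phi>)"
  by simp

lemma inst_num_subst:
  "inst (subst_fm (case_nat (Var 0) (\<lambda>i. nml (e i))) \<phi>) (nml m) = num_subst (case_nat m e) \<phi>"
  unfolding subst_fm_subst_fm by (rule subst_fm_cong) (simp split: nat.split)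

lemma plug_num_subst:
  "plug (subst_fm (case_nat (Var 0) (\<lambda>i. nml (e i))) \<phi>) (nml m) = num_subst (case_nat m e) \<phi>"
  unfolding subst_fm_subst_fm by (rule subst_fm_cong) (simp split: nat.split)

lemma prv_Eq_cong:
  assumes "prv (Eq s s')" "prv (Eq t t')"
  shows "prv (Imp (Eq s t) (Eq s' t'))"
proof -
  have wf: "wft s" "wft s'" "wft t" "wft t'" using assms[THEN prv_wf] by auto
  have "prv (Imp (Eq s t) (Eq s' t))"
    by (rule prv_imp_trans[OF prv_sym[OF assms(1)]]) (use wf in \<open>auto intro: prv_prop0\<close>)
  moreover have "prv (Imp (Eq s' t) (Imp (Eq t t') (Eq s' t')))"
    by (rule prv_trans_imp) (use wf in auto)
  ultimately show ?thesis using assms(2) by (rule prv_prop3) (use wf in auto)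
qed

lemma prv_Less_cong:
  assumes "prv (Eq s s')" "prv (Eq t t')"
  shows "prv (Imp (Less s t) (Less s' t'))"
proof -
  have wf: "wft s" "wft s'" "wft t" "wft t'" using assms[THEN prv_wf] by auto
  have inst: "inst (Less (Var 0) (lift_tm t)) r = Less r t"
    "inst (Less (lift_tm s') (Var 0)) r = Less s' r" for r
    unfolding subst_fm_Less by simp_all
  have 1: "prv (Imp (Less s t) (Less s' t))"
    by (rule prv_MP[OF prv_Leibniz[of "Less (Var 0) (lift_tm t)" s s', unfolded inst] assms(1)])
      (use wf in auto)
  have 2: "prv (Imp (Less s' t) (Less s' t'))"
    by (rule prv_MP[OF prv_Leibniz[of "Less (lift_tm s') (Var 0)" t t', unfolded inst] assms(2)])
      (use wf in auto)
  show ?thesis by (rule prv_prop2[OF 1 2]) (use wf in auto)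
qed

lemma prv_Less_nml:
  assumes "m < n"
  shows "prv (Less (nml m) (nml n))"
proof -
  obtain k where n: "n = m + Suc k" using assms less_iff_Suc_add by auto
  have "prv (Eq (Plus (nml m) (Succ (nml k))) (nml n))"
    using prv_Plus_nml[of m "Suc k"] by (simp add: n)
  from prv_MP[OF prv_Less_intro this] show ?thesis by simp
qed

lemma prv_not_Less_nml:
  assumes "\<not> m < n"
  shows "prv (Neg (Less (nml m) (nml n)))"
proof -
  \<comment> \<open>Every numeral below \<open>n\<close> differs from \<open>m\<close>; taking
    \<open>m\<close> itself for the variable contradicts reflexivity.\<close>
  have "prv (Imp (Less (Var 0) (nml n)) (Neg (Eq (Var 0) (nml m))))"
    by (rule prv_Less_nml_imp) (use assms prv_nml_neq in auto)
  then have "prv (subst_fm (\<lambda>_. nml m) (Imp (Less (Var 0) (nml n)) (Neg (Eq (Var 0) (nml m)))))"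
    by (rule prv_subst) simp
  then have "prv (Imp (Less (nml m) (nml n)) (Neg (Eq (nml m) (nml m))))" by simp
  moreover have "prv (Eq (nml m) (nml m))" by (rule prv_refl) simp
  ultimately show ?thesis by (rule prv_prop2) auto
qed

lemma decides_Eq:
  assumes "wft s" "wft t"
  shows "decides (Eq s t)"
  unfolding decides_def
proof (intro allI conjI impI)
  fix e
  let ?s = "subst_tm (\<lambda>i. nml (e i)) s" and ?t = "subst_tm (\<lambda>i. nml (e i)) t"
  note ev = prv_eval[OF assms(1), of e] prv_eval[OF assms(2), of e]
  have wf: "wft ?s" "wft ?t" using ev[THEN prv_wf] by auto
  show "prv (num_subst e (Eq s t))" if "sat (Eq s t) e"
    using prv_trans[OF ev(1) prv_sym[OF ev(2)[folded that[simplified]]]] by simp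
  show "prv (Neg (num_subst e (Eq s t)))" if "\<not> sat (Eq s t) e"
  proof -
    from that have "prv (Neg (Eq (nml (eval_tm s e)) (nml (eval_tm t e))))"
      by (intro prv_nml_neq) simp
    with prv_Eq_cong[OF ev] have "prv (Neg (Eq ?s ?t))"
      by (rule prv_prop2) (use wf in auto)
    then show ?thesis by simp
  qed
qed

lemma decides_Less:
  assumes "wft s" "wft t"
  shows "decides (Less s t)"
  unfolding decides_def subst_fm_Less sat_Less
proof (intro allI conjI impI)
  fix e
  let ?s = "subst_tm (\<lambda>i. nml (e i)) s" and ?t = "subst_tm (\<lambda>i. nml (e i)) t"
  note ev = prv_eval[OF assms(1), of e] prv_eval[OF assms(2), of e]
  have wf: "wft ?s" "wft ?t" using ev[THEN prv_wf] by auto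
  show "prv (Less ?s ?t)" if "eval_tm s e < eval_tm t e"
    using prv_Less_cong[OF ev[THEN prv_sym]] prv_Less_nml[OF that] by (rule prv_MP)
  show "prv (Neg (Less ?s ?t))" if "\<not> eval_tm s e < eval_tm t e"
    using prv_Less_cong[OF ev] prv_not_Less_nml[OF that] by (rule prv_prop2) (use wf in auto)
qed

lemma decides_Neg:
  assumes "decides \<phi>" "wf \<phi>"
  shows "decides (Neg \<phi>)"
proof -
  have "prv (Neg (Neg (num_subst e \<phi>)))" if "prv (num_subst e \<phi>)" for e
    using that by (rule prv_prop1) (use assms(2) in auto)
  with assms(1) show ?thesis by (simp add: decides_def)
qed

lemma decides_Imp:
  assumes "decides \<phi>" "decides \<psi>" "wf \<phi>" "wf \<psi>"
  shows "decides (Imp \<phi> \<psi>)"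
proof -
  have 1: "prv (Imp (num_subst e \<phi>) (num_subst e \<psi>))" if "prv (Neg (num_subst e \<phi>))" for e
    using that by (rule prv_prop1) (use assms in auto)
  have 2: "prv (Imp (num_subst e \<phi>) (num_subst e \<psi>))" if "prv (num_subst e \<psi>)" for e
    using that by (rule prv_prop1) (use assms in auto)
  have 3: "prv (Neg (Imp (num_subst e \<phi>) (num_subst e \<psi>)))"
    if "prv (num_subst e \<phi>)" "prv (Neg (num_subst e \<psi>))" for e
    using that by (rule prv_prop2) (use assms in auto)
  from 1 2 3 assms(1,2) show ?thesis unfolding decides_def subst_fm.simps sat.simps by blast
qed

text \<open>PA replaces the bound by its value. A true instance then amounts to finitely many
  numerals, and a false one has a numeral as counterexample.\<close>

lemma decides_BAll:
  assumes "decides \<phi>" "wf \<phi>" "wft t"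
  shows "decides (All (Imp (Less (Var 0) (lift_tm t)) \<phi>))"
  unfolding decides_def
proof (intro allI conjI impI)
  fix e
  let ?t = "subst_tm (\<lambda>i. nml (e i)) t" and ?\<phi> = "subst_fm (case_nat (Var 0) (\<lambda>i. nml (e i))) \<phi>"
  note ev = prv_eval[OF assms(3), of e]
  have wf: "wft ?t" using prv_wf[OF ev] by auto
  have wf_\<phi>: "wf ?\<phi>" using assms(2) by (rule wf_num_subst_up)
  have subst: "num_subst e (All (Imp (Less (Var 0) (lift_tm t)) \<phi>)) = All (Imp (Less (Var 0) ?t) ?\<phi>)"
    unfolding num_subst_All by (simp only: subst_fm.simps(3) subst_fm_Less) simp
  show "prv (num_subst e (All (Imp (Less (Var 0) (lift_tm t)) \<phi>)))"
    if sat: "sat (All (Imp (Less (Var 0) (lift_tm t)) \<phi>)) e"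
  proof -
    have "sat \<phi> (case_nat m e)" if "m < eval_tm t e" for m
      using sat that unfolding sat.simps(3,4) sat_Less by (auto simp: eval_subst_tm)
    then have "prv (plug ?\<phi> (nml m))" if "m < eval_tm t e" for m
      using assms(1) that unfolding plug_num_subst decides_def by blast
    then have "prv (Imp (Less (Var 0) (nml (eval_tm t e))) ?\<phi>)"
      by (intro prv_Less_nml_imp wf_\<phi>)
    moreover have "prv (Imp (Less (Var 0) ?t) (Less (Var 0) (nml (eval_tm t e))))"
      using ev by (intro prv_Less_cong prv_refl) simp
    ultimately have "prv (Imp (Less (Var 0) ?t) ?\<phi>)"
      by (rule prv_prop2) (use wf_\<phi> wf in auto)
    then show ?thesis unfolding subst by (rule prv_gen)
  qed
  show "prv (Neg (num_subst e (All (Imp (Less (Var 0) (lift_tm t)) \<phi>))))"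
    if nsat: "\<not> sat (All (Imp (Less (Var 0) (lift_tm t)) \<phi>)) e"
  proof -
    obtain m where m: "m < eval_tm t e" "\<not> sat \<phi> (case_nat m e)"
      using nsat unfolding sat.simps(3,4) sat_Less by (auto simp: eval_subst_tm)
    have wf_inst: "wf (inst ?\<phi> (nml m))" using wf_\<phi> by simp
    have "prv (Neg (inst ?\<phi> (nml m)))"
      using assms(1) m(2) unfolding inst_num_subst decides_def by blast
    moreover have "prv (Less (nml m) ?t)"
      by (rule prv_MP[OF prv_Less_cong[OF prv_refl prv_sym[OF ev]] prv_Less_nml[OF m(1)]]) simp
    moreover have "prv (Imp (All (Imp (Less (Var 0) ?t) ?\<phi>)) (Imp (Less (nml m) ?t) (inst ?\<phi> (nml m))))"
    proof -
      have "prv (Imp (All (Imp (Less (Var 0) ?t) ?\<phi>)) (inst (Imp (Less (Var 0) ?t) ?\<phi>) (nml m)))"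
        by (rule prv_All_inst) (use wf_\<phi> wf in auto)
      moreover have "subst_tm (case_nat (nml m) Var) ?t = ?t"
        unfolding subst_tm_subst_tm by simp
      then have "inst (Imp (Less (Var 0) ?t) ?\<phi>) (nml m) = Imp (Less (nml m) ?t) (inst ?\<phi> (nml m))"
        unfolding subst_fm.simps(3) subst_fm_Less by simp
      ultimately show ?thesis by (simp only:)
    qed
    ultimately show ?thesis unfolding subst by (rule prv_prop3) (use wf_\<phi> wf wf_inst in auto)
  qed
qed

lemma prv_All_imp_mono:
  assumes "prv (Imp \<phi> \<psi>)"
  shows "prv (Imp (All \<phi>) (All \<psi>))"
proof (rule prv_All_mono)
  have wf: "wf \<phi>" "wf \<psi>" using prv_wf[OF assms] by auto
  then show "wf (All \<phi>)" by simp
  let ?\<phi> = "subst_fm (case_nat (Var 0) (\<lambda>n. Var (Suc (Suc n)))) \<phi>"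
  have "inst ?\<phi> (Var 0) = \<phi>"
    unfolding subst_fm_subst_fm by (rule subst_fm_id) (simp split: nat.split)
  moreover have wf': "wf ?\<phi>"
    by (rule wf_fm_subst) (use wf in \<open>auto split: nat.split\<close>)
  ultimately have "prv (Imp (All ?\<phi>) \<phi>)"
    using prv_All_inst[of ?\<phi> "Var 0"] by simp
  then have "prv (Imp (All ?\<phi>) \<psi>)" using assms by (rule prv_prop2) (use wf wf' in auto)
  then show "prv (Imp (lift_fm (All \<phi>)) \<psi>)" by simp
qed

text \<open>Unfolding \<open>Exi\<close> and \<open>Conj\<close> gives the negation of a bounded
  universal quantifier, up to a double negation under \<open>All\<close>.\<close>

lemma decides_BEx:
  assumes "decides \<phi>" "wf \<phi>" "wft t"
  shows "decides (Exi (Conj (Less (Var 0) (lift_tm t)) \<phi>))"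
proof -
  let ?\<alpha> = "Imp (Less (Var 0) (lift_tm t)) (Neg \<phi>)"
  have dec: "decides (All ?\<alpha>)"
    by (rule decides_BAll) (use assms decides_Neg in auto)
  have wf: "wf ?\<alpha>" using assms by simp
  show ?thesis
    unfolding decides_def
  proof (intro allI conjI impI)
    fix e
    let ?\<beta> = "subst_fm (case_nat (Var 0) (\<lambda>i. nml (e i))) ?\<alpha>"
    have wf\<beta>: "wf ?\<beta>" using wf by (rule wf_num_subst_up)
    have 1: "prv (Imp (All ?\<beta>) (All (Neg (Neg ?\<beta>))))" "prv (Imp (All (Neg (Neg ?\<beta>))) (All ?\<beta>))"
      by (rule prv_All_imp_mono, rule prv_prop0, use wf\<beta> in simp, simp)+
    have subst: "num_subst e (Exi (Neg ?\<alpha>)) = Neg (All (Neg (Neg ?\<beta>)))"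
      by (simp only: num_subst_All subst_fm.simps(2))
    have sat: "sat (Exi (Neg ?\<alpha>)) e \<longleftrightarrow> \<not> sat (All ?\<alpha>) e" by (simp only: sat.simps) simp
    show "prv (num_subst e (Exi (Neg ?\<alpha>)))" if "sat (Exi (Neg ?\<alpha>)) e"
    proof -
      have "prv (Neg (All ?\<beta>))"
        using dec that unfolding sat decides_def num_subst_All by blast
      with 1(2) show ?thesis unfolding subst by (rule prv_prop2) (use wf\<beta> in auto)
    qed
    show "prv (Neg (num_subst e (Exi (Neg ?\<alpha>))))" if "\<not> sat (Exi (Neg ?\<alpha>)) e"
    proof -
      have "prv (All ?\<beta>)"
        using dec that unfolding sat decides_def num_subst_All by blast
      with 1(1) show ?thesis unfolding subst by (rule prv_prop2) (use wf\<beta> in auto)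
    qed
  qed
qed

lemma wf_tm_lift_iff [simp]: "wft (lift_tm t) \<longleftrightarrow> wft t"
  by (induction t rule: tm_induct) (auto simp: list_all_iff)

lemma delta0_decides: "delta0 \<phi> \<Longrightarrow> wf \<phi> \<Longrightarrow> decides \<phi>"
proof (induction rule: delta0.induct)
  case (1 s t)
  then show ?case by (auto intro: decides_Eq)
next
  case (2 s t)
  then show ?case by (intro decides_Less) auto
next
  case (3 \<phi>)
  then show ?case by (auto intro: decides_Neg)
next
  case (4 \<phi> \<psi>)
  then show ?case by (auto intro: decides_Imp)
next
  case (5 \<phi> t)
  then show ?case by (intro decides_BAll) auto
next
  case (6 \<phi> t)
  then show ?case by (intro decides_BEx) auto
qed

lemma sigma1_complete: "sigma1 \<phi> \<Longrightarrow> wf \<phi> \<Longrightarrow> sat \<phi> e \<Longrightarrow> prv (num_subst e \<phi>)"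
proof (induction arbitrary: e rule: sigma1.induct)
  case (1 \<phi>)
  then show ?case using delta0_decides unfolding decides_def by blast
next
  case (2 \<phi>)
  then obtain n where "sat \<phi> (case_nat n e)" by auto
  with 2 have 3: "prv (inst (subst_fm (case_nat (Var 0) (\<lambda>i. nml (e i))) \<phi>) (nml n))"
    unfolding inst_num_subst by (auto intro: "2.IH")
  have "wf \<phi>" using "2.prems" by simp
  with prv_MP[OF prv_Exi_inst[OF wf_num_subst_up] 3] show ?case by simp
qed

lemma prv_sound: "prv \<phi> \<Longrightarrow> sat \<phi> e"
  unfolding proves_def by (rule nd_sound[where \<Gamma> = "{}"]) (auto intro: PA_sound[OF language])

text \<open>Truth passes from \<open>Fml\<close> to its \<Sigma>1 equivalent by soundness of PA,
  \<Sigma>1 completeness proves the latter, and the provable equivalence leads back.\<close>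

lemma prv_Fml:
  assumes "delta1 F Fml" "expresses_Fml F Fml" "wf \<phi>"
  shows "prv (plug Fml (quot \<phi>))"
proof -
  obtain \<sigma> where \<sigma>: "sigma1 \<sigma>" "wf \<sigma>" "prv (Iff Fml \<sigma>)"
    using assms(1) by (auto simp: delta1_def)
  have wf: "wf Fml" using assms(1) by (simp add: delta1_def)
  \<comment> \<open>A constant assignment also closes parameters that \<open>\<sigma>\<close> may
    have besides variable 0.\<close>
  let ?e = "\<lambda>_. gn \<phi>"
  have "sat (plug Fml (quot \<phi>)) ?e"
    using assms(2,3) by (auto simp: expresses_Fml_def simp del: fun_upd_apply)
  then have "sat Fml ?e" by (simp add: sat_subst_fm if_distrib[of "\<lambda>t. eval_tm t _"] cong: if_cong)
  then have "sat \<sigma> ?e" using prv_sound[OF \<sigma>(3), of ?e] by simp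
  then have "prv (num_subst ?e \<sigma>)" by (rule sigma1_complete[OF \<sigma>(1,2)])
  moreover have "prv (num_subst ?e (Iff Fml \<sigma>))" using \<sigma>(3) by (rule prv_subst) simp
  ultimately have "prv (num_subst ?e Fml)" by (rule prv_prop2) (use wf in auto)
  moreover have "num_subst ?e Fml = plug Fml (quot \<phi>)"
    by (rule subst_fm_cong) (use assms(2) in \<open>auto simp: expresses_Fml_def\<close>)
  ultimately show ?thesis by simp
qed

end

section \<open>The diagonal function\<close>

text \<open>A common divisor divides \<open>(j - i) * b\<close> and is coprime to \<open>b\<close>,
  so it divides \<open>j - i\<close>, hence \<open>b\<close>, and is a unit.\<close>

lemma beta_moduli_coprime:
  fixes b :: nat
  assumes "i < j" "j - i dvd b"
  shows "coprime (Suc (Suc i * b)) (Suc (Suc j * b))"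
proof (rule coprimeI)
  fix d assume d: "d dvd Suc (Suc i * b)" "d dvd Suc (Suc j * b)"
  have "Suc (Suc j * b) - Suc (Suc i * b) = (j - i) * b"
    using assms(1) by (simp add: diff_mult_distrib)
  with d have "d dvd (j - i) * b" by (metis dvd_diff_nat)
  moreover have "coprime d b"
  proof -
    have "coprime (Suc (Suc i * b)) b"
      by (metis coprime_Suc_left_nat coprime_commute coprime_mult_right_iff)
    then show ?thesis using d(1) by (meson coprime_divisors dvd_refl)
  qed
  ultimately have "d dvd j - i" by (simp add: coprime_dvd_mult_left_iff)
  then have "d dvd b" using assms(2) by (rule dvd_trans)
  with \<open>coprime d b\<close> show "is_unit d" by (simp add: coprime_absorb_left)
qed

text \<open>Goedel's beta lemma, by the Chinese remainder theorem for these moduli.\<close>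

lemma beta_exists:
  fixes f :: "nat \<Rightarrow> nat"
  shows "\<exists>a b. \<forall>i\<le>n. a mod Suc (Suc i * b) = f i"
proof -
  \<comment> \<open>A factorial this large is divisible by all differences of indices up to
    \<open>n\<close>, which makes the moduli coprime, and is at least every \<open>f i\<close>, so
    that \<open>f i\<close> is the remainder and not merely congruent to it.\<close>
  define b :: nat where "b = fact (n + sum f {..n} + 1)"
  have "coprime (Suc (Suc i * b)) (Suc (Suc j * b))" if "i \<le> n" "j \<le> n" "i < j" for i j
  proof (rule beta_moduli_coprime[OF that(3)])
    show "j - i dvd b" unfolding b_def by (rule dvd_fact) (use that in auto)
  qed
  then have "coprime (Suc (Suc i * b)) (Suc (Suc j * b))" if "i \<le> n" "j \<le> n" "i \<noteq> j" for i j
    using that by (metis coprime_commute linorder_neqE_nat)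
  then obtain a where a: "\<forall>i\<in>{..n}. [a = f i] (mod Suc (Suc i * b))"
    using chinese_remainder_nat[of "{..n}" "\<lambda>i. Suc (Suc i * b)" f] by auto
  have "f i < Suc (Suc i * b)" if "i \<le> n" for i
  proof -
    have "f i \<le> sum f {..n}" using that by (intro member_le_sum) auto
    also have "\<dots> \<le> n + sum f {..n} + 1" by simp
    also have "\<dots> \<le> b" unfolding b_def by (rule fact_ge_self)
    finally show ?thesis by simp
  qed
  with a have "\<forall>i\<le>n. a mod Suc (Suc i * b) = f i" by (auto simp: cong_def simp del: mult_Suc)
  then show ?thesis by blast
qed

section \<open>Bounded formulas for the beta function\<close>

definition ball_fm :: "tm \<Rightarrow> fm \<Rightarrow> fm" where
  "ball_fm t \<phi> = All (Imp (Less (Var 0) (lift_tm t)) \<phi>)"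

definition bex_fm :: "tm \<Rightarrow> fm \<Rightarrow> fm" where
  "bex_fm t \<phi> = Exi (Conj (Less (Var 0) (lift_tm t)) \<phi>)"

lemma delta0_Conj: "delta0 \<phi> \<Longrightarrow> delta0 \<psi> \<Longrightarrow> delta0 (Conj \<phi> \<psi>)"
  by (intro delta0.intros)

lemma delta0_bounded:
  "delta0 \<phi> \<Longrightarrow> delta0 (ball_fm t \<phi>)" "delta0 \<phi> \<Longrightarrow> delta0 (bex_fm t \<phi>)"
  unfolding ball_fm_def bex_fm_def by (intro delta0.intros; assumption)+

lemma wf_bounded [simp]:
  assumes "wf_fm F \<phi>" "wf_tm F t"
  shows "wf_fm F (ball_fm t \<phi>)" "wf_fm F (bex_fm t \<phi>)"
  using assms by (auto simp: ball_fm_def bex_fm_def)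

lemma fv_tm_lift: "fv_tm (lift_tm t) = Suc ` fv_tm t"
  by (auto simp: fv_tm_subst)

lemma fv_Less: "fv_fm (Less s t) = fv_tm s \<union> fv_tm t"
  by (auto simp: fv_tm_lift)

lemma fv_bounded:
  "fv_fm (ball_fm t \<phi>) = fv_tm t \<union> {n. Suc n \<in> fv_fm \<phi>}"
  "fv_fm (bex_fm t \<phi>) = fv_tm t \<union> {n. Suc n \<in> fv_fm \<phi>}"
  unfolding ball_fm_def bex_fm_def by (auto simp: fv_tm_lift)

lemma ex_Suc_add_iff: "(\<exists>k. Suc (m + k) = n) \<longleftrightarrow> m < n" for m n :: nat
  by (auto simp: less_iff_Suc_add)

lemma sat_ball_fm [simp]: "sat (ball_fm t \<phi>) e \<longleftrightarrow> (\<forall>n<eval_tm t e. sat \<phi> (case_nat n e))"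
  unfolding ball_fm_def sat.simps(3,4) sat_Less by (simp add: eval_subst_tm)

lemma sat_bex_fm [simp]: "sat (bex_fm t \<phi>) e \<longleftrightarrow> (\<exists>n<eval_tm t e. sat \<phi> (case_nat n e))"
  by (auto simp: bex_fm_def eval_subst_tm ex_Suc_add_iff)

lemma subst_ball_fm:
  "subst_fm \<sigma> (ball_fm t \<phi>) =
    ball_fm (subst_tm \<sigma> t) (subst_fm (case_nat (Var 0) (\<lambda>n. lift_tm (\<sigma> n))) \<phi>)"
  unfolding ball_fm_def subst_fm.simps(3,4) subst_fm_Less by (simp add: subst_tm_subst_tm)

text \<open>Division with remainder: the bounded variable is the quotient, which is at most
  \<open>a\<close>, whence the bound \<open>Succ a\<close>.\<close>

definition beta_fm :: "tm \<Rightarrow> tm \<Rightarrow> tm \<Rightarrow> tm \<Rightarrow> fm" where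
  "beta_fm a b i r = (let m = Succ (Times (Succ i) b) in
     bex_fm (Succ a) (Conj (Eq (lift_tm a) (Plus (Times (Var 0) (lift_tm m)) (lift_tm r)))
       (Less (lift_tm r) (lift_tm m))))"

lemma delta0_beta_fm: "delta0 (beta_fm a b i r)"
  unfolding beta_fm_def Let_def by (intro delta0_Conj delta0_bounded delta0.intros)

lemma wf_beta_fm [simp]:
  "wf_tm F a \<Longrightarrow> wf_tm F b \<Longrightarrow> wf_tm F i \<Longrightarrow> wf_tm F r \<Longrightarrow> wf_fm F (beta_fm a b i r)"
  by (simp add: beta_fm_def)

lemma fv_beta_fm: "fv_fm (beta_fm a b i r) = fv_tm a \<union> fv_tm b \<union> fv_tm i \<union> fv_tm r"
  unfolding beta_fm_def Let_def fv_bounded fv_fm.simps(2,3) fv_Less by (auto simp: fv_tm_lift)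

lemma sat_beta_fm [simp]:
  "sat (beta_fm a b i r) e \<longleftrightarrow>
    eval_tm a e mod Suc (Suc (eval_tm i e) * eval_tm b e) = eval_tm r e"
proof -
  have "(\<exists>q<Suc a. a = q * m + r \<and> r < m) \<longleftrightarrow> a mod m = r" if "m > 0" for a m r :: nat
  proof
    assume "a mod m = r"
    then have "a = (a div m) * m + r" "r < m" using that by auto
    moreover have "a div m < Suc a" by (simp add: less_Suc_eq_le)
    ultimately show "\<exists>q<Suc a. a = q * m + r \<and> r < m" by blast
  qed auto
  moreover have "(\<exists>n. r + n = m) \<longleftrightarrow> r < Suc m" for r m :: nat
    by (auto simp: less_Suc_eq_le le_iff_add)
  moreover note calculation(1)[of "Suc (Suc (eval_tm i e) * eval_tm b e)" "eval_tm a e" "eval_tm r e"]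
  ultimately show ?thesis
    unfolding beta_fm_def Let_def sat_bex_fm sat.simps(1,2,3) sat_Less by (simp add: eval_subst_tm)
qed

text \<open>
  The code of \<open>\<forall>x (x = n \<longrightarrow> \<Psi>(x))\<close> in terms of the code \<open>n\<close> of \<open>\<Psi>\<close>
  and the code \<open>c\<close> of the numeral of \<open>n\<close>.
\<close>

definition diag_code :: "nat \<Rightarrow> nat \<Rightarrow> nat" where
  "diag_code n c = (let q = 2 * (c * Suc c) in 8 * ((q + n) * Suc (q + n) + 2 * q) + 11)"

text \<open>The triangular number in the pairing function contains a division by two; doubling
  leaves a polynomial, which is a term of the language.\<close>

lemma double_prod_encode: "2 * prod_encode (m, n) = (m + n) * Suc (m + n) + 2 * m"
  by (simp add: prod_encode_def triangle_def)

lemma gn_diag: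
  "gn (All (Imp (Eq (Var 0) (nml (gn \<Psi>))) \<Psi>)) = diag_code (gn \<Psi>) (gn_tm (nml (gn \<Psi>)))"
proof -
  define c where "c = gn_tm (nml (gn \<Psi>))"
  define p where "p = prod_encode (0, c)"
  have p: "4 * p = 2 * (c * Suc c)"
    using double_prod_encode[of 0 c] by (simp add: p_def)
  \<comment> \<open>The tags of \<open>All\<close> and \<open>Imp\<close> contribute
    \<open>4 * (4 * z + 2) + 3\<close>, that is \<open>8 * (2 * z) + 11\<close>.\<close>
  have "gn (All (Imp (Eq (Var 0) (nml (gn \<Psi>))) \<Psi>)) = 8 * (2 * prod_encode (4 * p, gn \<Psi>)) + 11"
    by (simp add: c_def p_def)
  also have "\<dots> = diag_code (gn \<Psi>) c"
    unfolding double_prod_encode p diag_code_def Let_def by simp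
  finally show ?thesis by (simp add: c_def)
qed

text \<open>
  Variable \<open>0\<close> is the value, variable \<open>1\<close> bounds the witnesses and variable \<open>i\<close> is the argument.
  The sequence coded by the beta function consists of the codes of the numerals up to the argument.
\<close>

definition diag_fm :: "nat \<Rightarrow> fm" where
  "diag_fm i = bex_fm (Var 1) (bex_fm (Var 2) (bex_fm (Var 3)
    (let c = Var 0; b = Var 1; a = Var 2; y = Var 3; x = Var (i + 3);
         q = Times (nml 2) (Times c (Succ c)); s = Plus q x in
     Conj (beta_fm a b Zero (nml 1)) (Conj (beta_fm a b x c)
       (Conj (ball_fm x (bex_fm (Succ (Var 3)) (Conj (beta_fm (Var 4) (Var 3) (Var 1) (Var 0))
           (beta_fm (Var 4) (Var 3) (Succ (Var 1)) (Plus (Times (nml 6) (Var 0)) (nml 2))))))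
         (Eq y (Plus (Times (nml 8) (Plus (Times s (Succ s)) (Times (nml 2) q))) (nml 11))))))))"

lemma delta0_diag_fm: "delta0 (diag_fm i)"
  unfolding diag_fm_def Let_def by (intro delta0_Conj delta0_bounded delta0_beta_fm delta0.intros)

lemma wf_diag_fm [simp]: "wf_fm F (diag_fm i)"
  by (simp add: diag_fm_def Let_def)

lemma fv_diag_fm: "fv_fm (diag_fm i) \<subseteq> {0, 1, i}"
  unfolding diag_fm_def Let_def fv_bounded fv_fm.simps(1,2,3) fv_beta_fm
  by (auto simp: numeral_eq_Suc)

text \<open>The meaning of \<open>diag_fm\<close>, with \<open>w\<close> bounding the beta
  parameters and the last code. The start 1 and the step \<open>6 * z + 2\<close> are the clauses of
  \<open>gn_tm\<close> for \<open>Zero\<close> and \<open>Succ\<close>.\<close>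

definition diag_witness :: "nat \<Rightarrow> nat \<Rightarrow> nat \<Rightarrow> bool" where
  "diag_witness n y w \<longleftrightarrow> (\<exists>a<w. \<exists>b<w. \<exists>c<w. a mod Suc b = 1 \<and> a mod Suc (Suc n * b) = c \<and>
     (\<forall>j<n. a mod Suc (Suc (Suc j) * b) = 6 * (a mod Suc (Suc j * b)) + 2) \<and> y = diag_code n c)"

lemma sat_diag_fm [simp]: "sat (diag_fm i) e \<longleftrightarrow> diag_witness (e i) (e 0) (e 1)"
proof -
  have "a mod m < Suc a" for a m :: nat by (simp add: less_Suc_eq_le)
  then show ?thesis
    unfolding diag_fm_def Let_def sat_bex_fm sat_ball_fm sat.simps(1,2,3) sat_beta_fm
      diag_witness_def diag_code_def
    by (simp add: numeral_eq_Suc)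
qed

text \<open>By induction the decoded sequence consists of the codes of the numerals up to
  \<open>n\<close>, whatever beta parameters are used.\<close>

lemma diag_witness_unique:
  assumes "diag_witness n y w"
  shows "y = diag_code n (gn_tm (nml n))"
proof -
  obtain a b where ab: "a mod Suc b = 1" "y = diag_code n (a mod Suc (Suc n * b))"
    "\<forall>j<n. a mod Suc (Suc (Suc j) * b) = 6 * (a mod Suc (Suc j * b)) + 2"
    using assms by (auto simp: diag_witness_def)
  have "a mod Suc (Suc j * b) = gn_tm (nml j)" if "j \<le> n" for j
    using that
  proof (induction j)
    case 0
    then show ?case using ab(1) by simp
  next
    case (Suc j)
    then show ?case using ab(3)[rule_format, of j] by simp
  qed
  with ab(2) show ?thesis by simp
qed

text \<open>The beta lemma codes the sequence of numeral codes; a sum containing \<open>y\<close>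
  serves as bound, so that it can also be made to exceed the value itself.\<close>

lemma diag_witness_exists: "\<exists>w>y. diag_witness n (diag_code n (gn_tm (nml n))) w"
proof -
  obtain a b where ab: "\<forall>i\<le>n. a mod Suc (Suc i * b) = gn_tm (nml i)"
    using beta_exists[of n "\<lambda>i. gn_tm (nml i)"] by auto
  let ?c = "gn_tm (nml n)"
  let ?w = "Suc (a + b + ?c + y)"
  have "a mod Suc b = 1" using ab[rule_format, of 0] by simp
  moreover have "\<forall>j<n. a mod Suc (Suc (Suc j) * b) = 6 * (a mod Suc (Suc j * b)) + 2"
    using ab by (simp del: mult_Suc)
  moreover have "a mod Suc (Suc n * b) = ?c" using ab by blast
  ultimately have "diag_witness n (diag_code n ?c) ?w"
    unfolding diag_witness_def
    by (intro exI[of _ a] conjI exI[of _ b] exI[of _ ?c]) auto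
  moreover have "y < ?w" by simp
  ultimately show ?thesis by blast
qed

section \<open>The fixed point lemma\<close>

text \<open>Variables 0, 1, 2 are value, bound and argument: the bound is the least one admitting a
  value below itself. Keeping values below their bounds makes minimality a bounded statement; inside
  it the argument has index 4 because of the two new quantifiers.\<close>

definition diag_least_fm :: fm where
  "diag_least_fm = Conj (Less (Var 0) (Var 1)) (Conj (diag_fm 2)
     (ball_fm (Var 1) (ball_fm (Var 0) (Neg (diag_fm 4)))))"

lemma delta0_diag_least_fm: "delta0 diag_least_fm"
  unfolding diag_least_fm_def
  by (intro delta0_Conj delta0_bounded delta0_diag_fm delta0.intros)

lemma wf_diag_least_fm [simp]: "wf_fm F diag_least_fm"
  by (simp add: diag_least_fm_def)

lemma fv_diag_least_fm: "fv_fm diag_least_fm \<subseteq> {0, 1, 2}"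
proof -
  have "{n. Suc (Suc n) \<in> fv_fm (diag_fm 4)} \<subseteq> {2}"
    using fv_diag_fm[of 4] by auto
  then show ?thesis
    using fv_diag_fm[of 2]
    unfolding diag_least_fm_def fv_fm.simps(2,3) fv_Less fv_bounded by auto
qed

lemma sat_diag_least_fm:
  "sat diag_least_fm e \<longleftrightarrow> e 0 < e 1 \<and> diag_witness (e 2) (e 0) (e 1) \<and>
    (\<forall>w<e 1. \<forall>y<w. \<not> diag_witness (e 2) y w)"
  unfolding diag_least_fm_def sat.simps(2,3) sat_Less sat_ball_fm sat_diag_fm
  by (simp add: numeral_eq_Suc ex_Suc_add_iff)

lemma subst_diag_least_fm:
  "subst_fm (\<lambda>i. if i = 0 then Var 0 else if i = 1 then t else nml k) diag_least_fm =
    Conj (Less (Var 0) t) (Conj (subst_fm (\<lambda>i. if i = 0 then Var 0 else if i = 1 then t else nml k) (diag_fm 2))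
      (ball_fm t (ball_fm (Var 0) (Neg (subst_fm (\<lambda>i. if i < 2 then Var i else nml k) (diag_fm 4))))))"
proof -
  have "subst_fm (case_nat (Var 0) (\<lambda>n. lift_tm (case_nat (Var 0)
      (\<lambda>n. lift_tm (if n = 0 then Var 0 else if n = 1 then t else nml k)) n))) (diag_fm 4)
    = subst_fm (\<lambda>i. if i < 2 then Var i else nml k) (diag_fm 4)"
    by (rule subst_fm_cong) (use fv_diag_fm[of 4] in \<open>auto simp: numeral_eq_Suc\<close>)
  then show ?thesis
    unfolding diag_least_fm_def subst_fm.simps(2,3) subst_fm_Less subst_ball_fm by simp
qed

context peano
begin

text \<open>For case distinctions on variable 1, the bound; variables 0 and 1 are exchanged before
  and after.\<close>

lemma prv_finite_cases_1:
  assumes "wf \<psi>" "\<And>m. m < n \<Longrightarrow> prv (subst_fm (Var(1 := nml m)) \<psi>)"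
    "prv (subst_fm (Var(1 := (Succ ^^ n) (Var 1))) \<psi>)"
  shows "prv \<psi>"
proof -
  let ?\<sigma> = "\<lambda>i. Var (if i = 0 then 1 else if i = 1 then 0 else i)"
  have plug: "plug (subst_fm ?\<sigma> \<psi>) (subst_tm ?\<sigma> t) = subst_fm ?\<sigma> (subst_fm (Var(1 := t)) \<psi>)" for t
    unfolding subst_fm_subst_fm by (rule subst_fm_cong) simp
  have pow: "subst_tm ?\<sigma> ((Succ ^^ n) (Var 1)) = (Succ ^^ n) (Var 0)"
    by (induction n) auto
  have "prv (subst_fm ?\<sigma> \<psi>)"
  proof (rule prv_finite_cases)
    show "wf (subst_fm ?\<sigma> \<psi>)" using assms(1) by (rule wf_fm_subst) simp
    show "prv (plug (subst_fm ?\<sigma> \<psi>) (nml m))" if "m < n" for m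
      using plug[of "nml m"] prv_subst[OF assms(2)[OF that], of ?\<sigma>] by (simp del: fun_upd_apply)
    show "prv (plug (subst_fm ?\<sigma> \<psi>) ((Succ ^^ n) (Var 0)))"
      using plug[of "(Succ ^^ n) (Var 1)"] prv_subst[OF assms(3), of ?\<sigma>]
      unfolding pow by (simp del: fun_upd_apply)
  qed
  then have "prv (subst_fm ?\<sigma> (subst_fm ?\<sigma> \<psi>))" by (rule prv_subst) simp
  moreover have "subst_fm ?\<sigma> (subst_fm ?\<sigma> \<psi>) = \<psi>"
    unfolding subst_fm_subst_fm by (rule subst_fm_id) simp
  ultimately show ?thesis by simp
qed

lemma prv_ball_inst:
  assumes "wf \<phi>" "wft t" "wft s"
  shows "prv (Imp (ball_fm t \<phi>) (Imp (Less s t) (inst \<phi> s)))"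
proof -
  have "inst (Imp (Less (Var 0) (lift_tm t)) \<phi>) s = Imp (Less s t) (inst \<phi> s)"
    unfolding subst_fm.simps(3) subst_fm_Less by simp
  then show ?thesis
    using prv_All_inst[of "Imp (Less (Var 0) (lift_tm t)) \<phi>" s] assms
    unfolding ball_fm_def by (simp only: wf_fm.simps wf_tm_lift wf_tm.simps)
qed

text \<open>A bound of the form \<open>w + 1 + x\<close> exceeds \<open>w\<close>, and then
  \<open>w\<close> together with \<open>y\<close> violates the minimality clause.\<close>

lemma prv_not_diag_least_fm:
  assumes "diag_witness k y w" "y < w"
  shows "prv (Neg (subst_fm (\<lambda>i. if i = 0 then Var 0 else if i = 1 then (Succ ^^ Suc w) (Var 1) else nml k)
    diag_least_fm))"
proof -
  let ?t = "(Succ ^^ Suc w) (Var 1)" and ?e = "case_nat y (case_nat w (\<lambda>_. k))"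
  let ?\<phi> = "ball_fm (Var 0) (Neg (subst_fm (\<lambda>i. if i < 2 then Var i else nml k) (diag_fm 4)))"
  let ?\<psi> = "Neg (subst_fm (\<lambda>i. if i = 0 then Var 0 else if i = 1 then nml w else nml k) (diag_fm 4))"
  have "wf (subst_fm (\<lambda>i. if i < 2 then Var i else nml k) (diag_fm 4))"
    by (rule wf_fm_subst) auto
  then have wf: "wf ?\<phi>" "wf ?\<psi>" by (auto intro!: wf_fm_subst)
  have wf2: "wf (subst_fm (\<lambda>i. if i = 0 then Var 0 else if i = 1 then ?t else nml k) (diag_fm 2))"
    by (rule wf_fm_subst) auto
  have inst_\<phi>: "inst ?\<phi> (nml w) = ball_fm (nml w) ?\<psi>"
    unfolding subst_ball_fm subst_fm.simps(2) subst_fm_subst_fm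
    by (auto intro!: arg_cong[where f = "ball_fm _"] subst_fm_cong split: nat.split)
  have inst_\<psi>: "inst ?\<psi> (nml y) = Neg (num_subst ?e (diag_fm 4))"
    unfolding subst_fm.simps(2) subst_fm_subst_fm
    by (auto intro!: subst_fm_cong split: nat.split)
  have "decides (diag_fm 4)" by (rule delta0_decides[OF delta0_diag_fm]) simp
  then have 1: "prv (num_subst ?e (diag_fm 4))"
    using assms(1) unfolding decides_def sat_diag_fm by (auto simp: numeral_eq_Suc)
  have "prv (Imp (ball_fm (nml w) ?\<psi>) (Imp (Less (nml y) (nml w)) (inst ?\<psi> (nml y))))"
    by (rule prv_ball_inst) (use wf in auto)
  then have 2: "prv (Neg (ball_fm (nml w) ?\<psi>))"
    unfolding inst_\<psi> using prv_Less_nml[OF assms(2)] 1 by (rule prv_prop3) (use wf in auto)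
  have "prv (Imp (ball_fm ?t ?\<phi>) (Imp (Less (nml w) ?t) (inst ?\<phi> (nml w))))"
    by (rule prv_ball_inst) (use wf in auto)
  then have "prv (Neg (ball_fm ?t ?\<phi>))"
    unfolding inst_\<phi> using prv_nml_Less_Succ_pow 2 by (rule prv_prop3) (use wf in auto)
  then show ?thesis unfolding subst_diag_least_fm by (rule prv_prop1) (use wf wf2 in auto)
qed

text \<open>Uniqueness of the value inside PA. Bounds above \<open>w\<close> are excluded by
  minimality, and each of the finitely many others leaves finitely many values, at which the formula
  is decided; it can hold only at \<open>y\<close>, where \<open>\<Phi>\<close> fails by
  assumption.\<close>

lemma prv_diag_least_fm_imp:
  assumes w: "diag_witness k y w" "y < w" and y: "\<And>y' w'. diag_witness k y' w' \<Longrightarrow> y' = y"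
    and \<Phi>: "wf \<Phi>" "fv_fm \<Phi> \<subseteq> {0}"
  shows "prv (Imp (Neg (plug \<Phi> (nml y)))
    (Imp (subst_fm (\<lambda>i. if i < 2 then Var i else nml k) diag_least_fm) (Neg \<Phi>)))" (is "prv ?\<chi>")
proof (rule prv_finite_cases_1)
  let ?\<sigma> = "\<lambda>t i. if i = 0 then Var 0 else if i = 1 then t else nml k"
  have wf: "wf (subst_fm (?\<sigma> t) diag_least_fm)" "wf (subst_fm (?\<sigma> t) (diag_fm 2))"
    "wf (subst_fm (\<lambda>i. if i < 2 then Var i else nml k) (diag_fm 4))" if "wft t" for t
    by (rule wf_fm_subst; use that in simp)+
  have plug_\<Phi>: "subst_fm \<tau> (plug \<Phi> (nml y)) = plug \<Phi> (nml y)" for \<tau>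
    unfolding subst_fm_subst_fm by (rule subst_fm_cong) (use \<Phi>(2) in auto)
  have subst: "subst_fm (Var(1 := t)) ?\<chi> =
      Imp (Neg (plug \<Phi> (nml y))) (Imp (subst_fm (?\<sigma> t) diag_least_fm) (Neg \<Phi>))" for t
  proof -
    have "subst_fm (Var(1 := t)) \<Phi> = \<Phi>" by (rule subst_fm_id) (use \<Phi>(2) in auto)
    moreover have "subst_fm (Var(1 := t)) (subst_fm (\<lambda>i. if i < 2 then Var i else nml k) diag_least_fm)
        = subst_fm (?\<sigma> t) diag_least_fm"
      unfolding subst_fm_subst_fm by (rule subst_fm_cong) auto
    ultimately show ?thesis unfolding subst_fm.simps(2,3) plug_\<Phi> by simp
  qed
  show "wf ?\<chi>" using \<Phi>(1) by (auto intro!: wf_fm_subst)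
  show "prv (subst_fm (Var(1 := (Succ ^^ Suc w) (Var 1))) ?\<chi>)"
    unfolding subst using prv_not_diag_least_fm[OF w]
    by (rule prv_prop1) (use \<Phi>(1) wf[of "(Succ ^^ Suc w) (Var 1)"] in auto)
  fix m
  let ?\<psi> = "Imp (Neg (plug \<Phi> (nml y))) (Imp (subst_fm (?\<sigma> (nml m)) diag_least_fm) (Neg \<Phi>))"
  \<comment> \<open>With the bound fixed as \<open>m\<close>, the first clause of
    \<open>diag_least_fm\<close> restricts the value to numbers below \<open>m\<close>.\<close>
  have "prv (Imp (Less (Var 0) (nml m)) ?\<psi>)"
  proof (rule prv_Less_nml_imp)
    show "wf ?\<psi>" using \<Phi>(1) wf[of "nml m"] by simp
    fix j
    let ?e = "case_nat j (case_nat m (\<lambda>_. k))"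
    have plug: "plug ?\<psi> (nml j) =
        Imp (Neg (plug \<Phi> (nml y))) (Imp (num_subst ?e diag_least_fm) (Neg (plug \<Phi> (nml j))))"
    proof -
      have "plug (subst_fm (?\<sigma> (nml m)) diag_least_fm) (nml j) = num_subst ?e diag_least_fm"
        unfolding subst_fm_subst_fm by (rule subst_fm_cong) (simp split: nat.split)
      then show ?thesis unfolding subst_fm.simps(2,3) plug_\<Phi> by simp
    qed
    have dec: "decides diag_least_fm" by (rule delta0_decides[OF delta0_diag_least_fm]) simp
    show "prv (plug ?\<psi> (nml j))"
    proof (cases "sat diag_least_fm ?e")
      case True
      then have "j = y" using y by (auto simp: sat_diag_least_fm numeral_eq_Suc)
      then show ?thesis unfolding plug by (intro prv_prop0) (use \<Phi>(1) in auto)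
    next
      case False
      then have "prv (Neg (num_subst ?e diag_least_fm))" using dec unfolding decides_def by blast
      then show ?thesis unfolding plug by (rule prv_prop1) (use \<Phi>(1) in auto)
    qed
  qed
  then show "prv (subst_fm (Var(1 := nml m)) ?\<chi>)"
    unfolding subst subst_diag_least_fm
    by (rule prv_prop1) (use \<Phi>(1) wf[of "nml m"] in auto)
qed

lemma fixed_point:
  assumes \<Phi>: "wf \<Phi>" "fv_fm \<Phi> \<subseteq> {0}"
  obtains G where "wf G" "prv (Iff G (Neg (plug \<Phi> (quot G))))"
proof -
  \<comment> \<open>The outer quantifier binds the bound, the inner one the value.
    \<open>\<Psi>(x)\<close> thus says that the code of the diagonal sentence for \<open>x\<close>
    does not satisfy \<open>\<Phi>\<close>.\<close>
  define \<Psi> where "\<Psi> = All (All (Imp diag_least_fm (Neg \<Phi>)))"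
  define k where "k = gn \<Psi>"
  define G where "G = All (Imp (Eq (Var 0) (nml k)) \<Psi>)"
  \<comment> \<open>\<open>B\<close> is \<open>\<Psi>\<close> at its own code, to which
    \<open>G\<close> is shown equivalent before anything is said about
    \<open>\<Phi>\<close>.\<close>
  define B where "B = All (All (Imp (subst_fm (\<lambda>i. if i < 2 then Var i else nml k) diag_least_fm) (Neg \<Phi>)))"
  define y where "y = gn G"
  have wf_subst: "wf (subst_fm (\<lambda>i. if i < 2 then Var i else nml k) diag_least_fm)"
    by (rule wf_fm_subst) auto
  have wf: "wf \<Psi>" "wf G" "wf B" using \<Phi>(1) wf_subst by (auto simp: \<Psi>_def G_def B_def)
  have y: "y = diag_code k (gn_tm (nml k))" unfolding y_def G_def k_def by (rule gn_diag)
  have uniq: "y' = y" if "diag_witness k y' w'" for y' w'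
    using diag_witness_unique[OF that] y by simp
  define w where "w = (LEAST w. y < w \<and> diag_witness k y w)"
  have "\<exists>w. y < w \<and> diag_witness k y w" using diag_witness_exists[of y k] y by auto
  then have w: "y < w" "diag_witness k y w"
    unfolding w_def by (metis (mono_tags, lifting) LeastI)+
  \<comment> \<open>A competing value equals \<open>y\<close> by uniqueness, so a smaller bound
    would contradict the choice of \<open>w\<close>.\<close>
  have least: "\<not> diag_witness k y' w'" if "w' < w" "y' < w'" for y' w'
    using not_less_Least[of w' "\<lambda>w. y < w \<and> diag_witness k y w"] that uniq w_def by auto

  have fv_\<Psi>: "fv_fm \<Psi> \<subseteq> {0}"
    using fv_diag_least_fm \<Phi>(2) by (auto simp: \<Psi>_def)
  have inst_\<Psi>: "inst \<Psi> (nml k) = B"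
  proof -
    have "subst_fm (case_nat (Var 0) (\<lambda>n. lift_tm (case_nat (Var 0) (\<lambda>n. lift_tm (case_nat (nml k) Var n)) n)))
        diag_least_fm = subst_fm (\<lambda>i. if i < 2 then Var i else nml k) diag_least_fm"
      by (rule subst_fm_cong) (use fv_diag_least_fm in \<open>auto simp: numeral_eq_Suc\<close>)
    moreover have "subst_fm (case_nat (Var 0) (\<lambda>n. lift_tm (case_nat (Var 0) (\<lambda>n. lift_tm (case_nat (nml k) Var n)) n)))
        \<Phi> = \<Phi>"
      by (rule subst_fm_id) (use \<Phi>(2) in auto)
    ultimately show ?thesis unfolding \<Psi>_def B_def by simp
  qed
  have inst_\<Psi>_0: "inst \<Psi> (Var 0) = \<Psi>"
    by (rule subst_fm_id) (use fv_\<Psi> in auto)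
  have lift_B: "lift_fm B = B"
    unfolding inst_\<Psi>[symmetric] subst_fm_subst_fm
    by (rule subst_fm_cong) (use fv_\<Psi> in auto)

  have G_B: "prv (Imp G B)"
  proof -
    have "prv (Imp G (inst (Imp (Eq (Var 0) (nml k)) \<Psi>) (nml k)))"
      unfolding G_def by (rule prv_All_inst) (use wf in auto)
    then have "prv (Imp G (Imp (Eq (nml k) (nml k)) B))" by (simp add: inst_\<Psi>)
    moreover have "prv (Eq (nml k) (nml k))" by (rule prv_refl) simp
    ultimately show ?thesis by (rule prv_prop2) (use wf in auto)
  qed
  have B_G: "prv (Imp B G)"
    unfolding G_def
  proof (rule prv_All_mono)
    \<comment> \<open>Leibniz moves \<open>\<Psi>\<close> from its code to a variable equal to it;
      \<open>B\<close> has no free variables, so generalization is allowed.\<close>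
    have "prv (Imp (Eq (nml k) (Var 0)) (Imp B \<Psi>))"
      using prv_Leibniz[of \<Psi> "nml k" "Var 0"] wf unfolding inst_\<Psi> inst_\<Psi>_0 by simp
    moreover have "prv (Imp (Eq (Var 0) (nml k)) (Eq (nml k) (Var 0)))"
      by (rule prv_sym_imp) auto
    ultimately have "prv (Imp B (Imp (Eq (Var 0) (nml k)) \<Psi>))"
      by (rule prv_prop2) (use wf in auto)
    then show "prv (Imp (lift_fm B) (Imp (Eq (Var 0) (nml k)) \<Psi>))" by (simp only: lift_B)
  qed (use wf in simp)

  \<comment> \<open>The actual value and least bound are put for the quantifiers of
    \<open>B\<close>; at these numerals \<open>diag_least_fm\<close> is true, hence
    provable.\<close>
  let ?e = "case_nat y (case_nat w (\<lambda>_. k))"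
  have B_\<Phi>: "prv (Imp B (Neg (plug \<Phi> (nml y))))"
  proof -
    let ?\<phi> = "Imp (subst_fm (\<lambda>i. if i < 2 then Var i else nml k) diag_least_fm) (Neg \<Phi>)"
    let ?\<psi> = "Imp (subst_fm (\<lambda>i. if i = 0 then Var 0 else if i = 1 then nml w else nml k) diag_least_fm) (Neg \<Phi>)"
    have wf_\<psi>: "wf ?\<psi>" using \<Phi>(1) by (auto intro!: wf_fm_subst)
    have "inst (All ?\<phi>) (nml w) = All ?\<psi>"
    proof -
      have "subst_fm (case_nat (Var 0) (\<lambda>n. lift_tm (case_nat (nml w) Var n))) \<Phi> = \<Phi>"
        by (rule subst_fm_id) (use \<Phi>(2) in auto)
      moreover have "subst_fm (case_nat (Var 0) (\<lambda>n. lift_tm (case_nat (nml w) Var n)))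
          (subst_fm (\<lambda>i. if i < 2 then Var i else nml k) diag_least_fm)
        = subst_fm (\<lambda>i. if i = 0 then Var 0 else if i = 1 then nml w else nml k) diag_least_fm"
        unfolding subst_fm_subst_fm by (rule subst_fm_cong) (auto split: nat.split)
      ultimately show ?thesis unfolding subst_fm.simps by simp
    qed
    then have 1: "prv (Imp B (All ?\<psi>))"
      using prv_All_inst[of "All ?\<phi>" "nml w"] wf_subst \<Phi>(1) unfolding B_def by simp
    have "inst ?\<psi> (nml y) = Imp (num_subst ?e diag_least_fm) (Neg (plug \<Phi> (nml y)))"
    proof -
      have "inst \<Phi> (nml y) = plug \<Phi> (nml y)"
        by (rule subst_fm_cong) (use \<Phi>(2) in auto)
      moreover have "inst (subst_fm (\<lambda>i. if i = 0 then Var 0 else if i = 1 then nml w else nml k) diag_least_fm) (nml y)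
          = num_subst ?e diag_least_fm"
        unfolding subst_fm_subst_fm by (rule subst_fm_cong) (auto split: nat.split)
      ultimately show ?thesis unfolding subst_fm.simps by simp
    qed
    then have 2: "prv (Imp (All ?\<psi>) (Imp (num_subst ?e diag_least_fm) (Neg (plug \<Phi> (nml y)))))"
      using prv_All_inst[of ?\<psi> "nml y"] wf_\<psi> by simp
    have "sat diag_least_fm ?e"
      unfolding sat_diag_least_fm using w least by (simp add: numeral_eq_Suc)
    moreover have "decides diag_least_fm" by (rule delta0_decides[OF delta0_diag_least_fm]) simp
    ultimately have 3: "prv (num_subst ?e diag_least_fm)" unfolding decides_def by blast
    show ?thesis by (rule prv_prop3[OF 1 2 3]) (use wf \<Phi>(1) in auto)
  qed
  have \<Phi>_B: "prv (Imp (Neg (plug \<Phi> (nml y))) B)"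
  proof -
    \<comment> \<open>This is a sentence, hence unchanged by lifting, and both quantifiers of
      \<open>B\<close> can be introduced behind it.\<close>
    let ?\<phi> = "Neg (plug \<Phi> (nml y))"
    have lift: "lift_fm ?\<phi> = ?\<phi>"
      unfolding subst_fm.simps subst_fm_subst_fm
      by (intro arg_cong[where f = Neg] subst_fm_cong) (use \<Phi>(2) in auto)
    have wf': "wf ?\<phi>" using \<Phi>(1) by simp
    have mono: "prv (Imp ?\<phi> (All \<psi>))" if "prv (Imp ?\<phi> \<psi>)" for \<psi>
      by (rule prv_All_mono[OF _ wf']) (unfold lift, rule that)
    show ?thesis
      unfolding B_def by (rule mono)+ (rule prv_diag_least_fm_imp[OF w(2,1) uniq \<Phi>])
  qed
  have "prv (Imp G (Neg (plug \<Phi> (nml y))))"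
    by (rule prv_prop2[OF G_B B_\<Phi>]) (use wf \<Phi>(1) in auto)
  moreover have "prv (Imp (Neg (plug \<Phi> (nml y))) G)"
    by (rule prv_prop2[OF \<Phi>_B B_G]) (use wf \<Phi>(1) in auto)
  ultimately have "prv (Iff G (Neg (plug \<Phi> (nml y))))"
    by (rule prv_prop2) (use wf \<Phi>(1) in auto)
  with wf(2) show ?thesis unfolding y_def by (rule that)
qed

end

section \<open>Unprovability of consistency\<close>

theorem theorem2p8:
  fixes F :: "fsym set" and S T :: "fm set" and Fml \<Phi> :: fm and ng :: tm
  assumes "pr_language F"
    and "recursively_axiomatized F S" and "consistent F S" and "extends F S (PA F)"
    and "recursively_axiomatized F T" and "consistent F T" and "extends F T (PA F)"
    and "extends F T S"
    and "delta1 F Fml" and "expresses_Fml F Fml"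
    and "negation_term F ng"
    and "wf_fm F \<Phi>" and "fv_fm \<Phi> \<subseteq> {0}"
    and "D1 F S T \<Phi>" and "B2 F S T \<Phi>" and "D3 F S \<Phi>"
  shows "\<not> proves F T (ConH Fml ng \<Phi>)"
proof
  assume Con: "proves F T (ConH Fml ng \<Phi>)"
  interpret PA: peano F by unfold_locales (rule assms(1))
  interpret T: wf_theory F T
    using assms(5) by unfold_locales (simp add: recursively_axiomatized_def)
  have PA_T: "T.prv \<phi>" if "PA.prv \<phi>" for \<phi> using assms(7) that by (simp add: extends_def)
  have S_T: "T.prv \<phi>" if "proves F S \<phi>" for \<phi> using assms(8) that by (simp add: extends_def)
  note \<Phi> = assms(12,13)
  have wf_Fml: "T.wf Fml" using assms(9) by (simp add: delta1_def)
  have wf_ng: "T.wft ng" using assms(11) by (simp add: negation_term_def)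
  obtain G where wf_G: "T.wf G" and "PA.prv (Iff G (Neg (plug \<Phi> (quot G))))"
    using PA.fixed_point[OF \<Phi>] by blast
  then have G: "T.prv (Iff G (Neg (plug \<Phi> (quot G))))" by (intro PA_T)
  let ?P = "\<lambda>\<phi>. plug \<Phi> (quot \<phi>)"
  have wf_P: "T.wf (?P \<phi>)" for \<phi> using \<Phi>(1) by simp

  have "T.prv (Imp (?P G) (Neg G))"
    by (rule T.prv_prop1[OF G]) (use wf_G wf_P in auto)
  \<comment> \<open>\<open>B2\<close> takes the implication from \<open>T\<close> and concludes in
    \<open>S\<close>; the extension brings the result back to \<open>T\<close>.\<close>
  then have 1: "T.prv (Imp (?P (?P G)) (?P (Neg G)))"
    using assms(15) wf_G wf_P[of G] unfolding B2_def wf_fm.simps(2)[of F G, symmetric]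
    by (blast intro: S_T)
  have 2: "T.prv (Imp (?P G) (?P (?P G)))"
    using assms(16) wf_G by (intro S_T) (simp add: D3_def)

  have 3: "T.prv (Imp (?P G) (Neg (?P (Neg G))))"
  proof -
    let ?n = "subst_tm (Var(0 := quot G)) ng"
    have wf_n: "T.wft ?n" using wf_ng by (rule wf_tm_subst) simp
    \<comment> \<open>\<open>inst\<close> and \<open>plug\<close> differ only on variables other
      than 0, which are not free in \<open>Fml\<close>, \<open>\<Phi>\<close> and
      \<open>ng\<close>.\<close>
    have inst_Fml: "inst Fml (quot G) = plug Fml (quot G)"
      by (rule subst_fm_cong) (use assms(10) in \<open>auto simp: expresses_Fml_def\<close>)
    have inst_\<Phi>: "inst \<Phi> t = plug \<Phi> t" for t
      by (rule subst_fm_cong) (use \<Phi>(2) in auto)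
    have inst_ng: "inst (plug \<Phi> ng) (quot G) = plug \<Phi> ?n"
    proof -
      have "subst_tm (case_nat (quot G) Var) ng = ?n"
        by (rule subst_tm_cong) (use assms(11) in \<open>auto simp: negation_term_def\<close>)
      then show ?thesis
        unfolding subst_fm_subst_fm by (intro subst_fm_cong) (use \<Phi>(2) in auto)
    qed
    have "T.prv (inst (Imp (Conj Fml \<Phi>) (Neg (plug \<Phi> ng))) (quot G))"
      using Con unfolding ConH_def proves_def by (rule nd.AllE) simp
    then have "T.prv (Imp (Conj (plug Fml (quot G)) (?P G)) (Neg (plug \<Phi> ?n)))"
      unfolding subst_fm.simps inst_Fml inst_\<Phi> inst_ng .
    moreover have "T.prv (plug Fml (quot G))"
      by (intro PA_T PA.prv_Fml assms(9,10) wf_G)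
    \<comment> \<open>The negation term at the code of \<open>G\<close> is provably equal to the
      numeral of \<open>Neg G\<close> without being that numeral, so Leibniz has to carry
      \<open>\<Phi>\<close> across.\<close>
    moreover have "T.prv (Imp (?P (Neg G)) (plug \<Phi> ?n))"
    proof -
      have "T.prv (Eq ?n (quot (Neg G)))"
        using assms(11) wf_G by (intro PA_T) (simp add: negation_term_def)
      then have "T.prv (Eq (quot (Neg G)) ?n)" by (rule T.prv_sym)
      moreover have "T.prv (Imp (Eq (quot (Neg G)) ?n) (Imp (inst \<Phi> (quot (Neg G))) (inst \<Phi> ?n)))"
        by (rule T.prv_Leibniz) (use \<Phi>(1) wf_n in auto)
      ultimately show ?thesis unfolding inst_\<Phi> by (blast intro: T.prv_MP)
    qed
    ultimately show ?thesis
      by (rule T.prv_prop3) (use wf_P wf_Fml \<Phi>(1) wf_n in auto)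
  qed

  have not_PG: "T.prv (Neg (?P G))"
    by (rule T.prv_prop3[OF 1 2 3]) (use wf_P in auto)
  have "T.prv G"
    by (rule T.prv_prop2[OF G not_PG]) (use wf_G in auto)
  then have "T.prv (?P G)"
    using assms(14) wf_G by (intro S_T) (simp add: D1_def)
  with not_PG assms(6) show False by (auto simp: consistent_def)
qed

end
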